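(* Let $(\mathcal X,d,\mu)$ be a space of homogeneous type, $1\le p_0<q_0\le\infty$, and let $\{T_t\}_{t>0}$ be a family of sublinear operators that satisfies $L^p(\mu)-L^q(\mu)$ off-diagonal estimates on balls for all $p,q$ with $p_0<p\le q<q_0$. Then for all $p,q$ with $p_0<p\le q<q_0$ and for any weight $w\in A_{p/p_0}\cap RH_{(q_0/q)'}$, $\{T_t\}_{t>0}$ satisfies $L^p(w)-L^q(w)$ off-diagonal estimates on balls.
   Context: A space of homogeneous type $(\mathcal X,d,\mu)$ is a nonempty set $\mathcal X$ with a distance $d$ and a nonnegative (nonzero) Borel measure $\mu$ such that for some $C_0$, $\mu(B(x,2r))\le C_0\,\mu(B(x,r))<\infty$ for all $x\in\mathcal X$, $r>0$. For a ball $B=B(x_B,r_B)$ write $\lambda B=B(x_B,\lambda r_B)$ and $C_j(B)=2^{j+1}B\setminus 2^jB$ for $j\ge2$. Put $\Upsilon(s)=\max\{s,s^{-1}\}$ for $s>0$; $\chi_E$ is the indicator function of $E$. For a doubling Borel measure $\nu$ on $\mathcal X$ and $1\le p\le q\le\infty$, $\{T_t\}_{t>0}$ satisfies $L^p(\nu)-L^q(\nu)$ off-diagonal estimates on balls if there exist $\theta_1,\theta_2>0$, $c>0$ and $C>0$ such that for every $t>0$, every ball $B$ with radius $r=r_B$, and all $f$, $$\Big(\tfrac1{\nu(B)}\int_B|T_t(\chi_Bf)|^q d\nu\Big)^{1/q}\le C\,\Upsilon\big(\tfrac r{\sqrt t}\big)^{\theta_2}\Big(\tfrac1{\nu(B)}\int_B|f|^pd\nu\Big)^{1/p},$$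 and for all $j\ge2$ $$\Big(\tfrac1{\nu(B)}\int_B|T_t(\chi_{C_j(B)}f)|^q d\nu\Big)^{1/q}\le C\,2^{j\theta_1}\Upsilon\big(\tfrac{2^jr}{\sqrt t}\big)^{\theta_2}e^{-\frac{c4^jr^2}{t}}\Big(\tfrac1{\nu(2^{j+1}B)}\int_{C_j(B)}|f|^pd\nu\Big)^{1/p},$$ $$\Big(\tfrac1{\nu(2^{j+1}B)}\int_{C_j(B)}|T_t(\chi_{B}f)|^q d\nu\Big)^{1/q}\le C\,2^{j\theta_1}\Upsilon\big(\tfrac{2^jr}{\sqrt t}\big)^{\theta_2}e^{-\frac{c4^jr^2}{t}}\Big(\tfrac1{\nu(B)}\int_{B}|f|^pd\nu\Big)^{1/p}.$$ (Essential suprema when $q=\infty$.) The operators are defined on some space of functions stable under truncation by indicator functions of measurable sets, and the estimates are for $f$ in that space. A weight $w$ is a nonnegative locally integrable function; $L^p(w)$ and the $L^p(w)-L^q(w)$ estimates refer to the measure $\nu$ with $d\nu=dw=w\,d\mu$ (which is doubling for $w\in A_\infty=\bigcup_pA_p$). For $1<p<\infty$, $w\in A_p$ means $\big(\frac1{\mu(B)}\int_Bw\,d\mu\big)\big(\frac1{\mu(B)}\int_Bw^{1-p'}d\mu\big)^{p-1}\le C$ for all balls $B$. For $1<s<\infty$, $w\in RH_s$ means $\big(\frac1{\mu(B)}\int_Bw^sd\mu\big)^{1/s}\le C\frac1{\mu(B)}\int_Bw\,d\mu$ for all balls $B$; $RH_1$ is the class of all weights. $s'$ is the conjugate exponent of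 $s$, with $\infty'=1$. *)

theory Defs
  imports "HOL-Analysis.Analysis" "HOL-Probability.Essential_Supremum"
begin

(* Powers of extended nonnegative reals, for exponents a \<noteq> 0 only.
   Unlike powr on the reals, 0 raised to a negative exponent is infinite; this matters
   for the factor w^(1-p') in the A_p condition where the weight vanishes. *)
definition enn_powr :: "ennreal \<Rightarrow> real \<Rightarrow> ennreal" where
  "enn_powr x a =
     (if x = 0 \<and> a < 0 \<or> x = \<infinity> \<and> a > 0 then \<infinity> else ennreal (enn2real x powr a))"

definition conj_exp :: "ennreal \<Rightarrow> ennreal" where
  "conj_exp s = (if s = \<infinity> then 1 else s / (s - 1))"

(* The underlying set is the whole (automatically nonempty) type. *)
definition homogeneous_type :: "'a::metric_space measure \<Rightarrow> bool" where
  "homogeneous_type M \<longleftrightarrow>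
     sets M = sets borel \<and> emeasure M UNIV \<noteq> 0 \<and>
     (\<exists>C0::real. \<forall>x. \<forall>r>0.
        emeasure M (ball x (2 * r)) \<le> ennreal C0 * emeasure M (ball x r) \<and>
        emeasure M (ball x r) < \<infinity>)"

definition avg :: "'a measure \<Rightarrow> 'a set \<Rightarrow> ('a \<Rightarrow> ennreal) \<Rightarrow> ennreal" where
  "avg M B f = (\<integral>\<^sup>+y\<in>B. f y \<partial>M) / emeasure M B"


subsection \<open>Weights\<close>

(* Locally integrable is understood as integrable on every ball. *)
definition weight :: "'a::metric_space measure \<Rightarrow> ('a \<Rightarrow> real) \<Rightarrow> bool" where
  "weight M w \<longleftrightarrow>
     w \<in> borel_measurable M \<and> (\<forall>y. 0 \<le> w y) \<and>
     (\<forall>x. \<forall>r>0. set_integrable M (ball x r) w)"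

(* Meaningful for 1 < p < \<infinity>. *)
definition Ap :: "'a::metric_space measure \<Rightarrow> ennreal \<Rightarrow> ('a \<Rightarrow> real) set" where
  "Ap M p = {w. weight M w \<and>
     (\<exists>C::real. \<forall>x. \<forall>r>0.
        avg M (ball x r) w *
        enn_powr (avg M (ball x r) (\<lambda>y. enn_powr (w y) (1 - enn2real (conj_exp p))))
                 (enn2real p - 1) \<le> ennreal C)}"

(* Meaningful for 1 \<le> s < \<infinity>. *)
definition RH :: "'a::metric_space measure \<Rightarrow> ennreal \<Rightarrow> ('a \<Rightarrow> real) set" where
  "RH M s = {w. weight M w \<and>
     (s = 1 \<or>
      (\<exists>C::real. \<forall>x. \<forall>r>0.
        enn_powr (avg M (ball x r) (\<lambda>y. enn_powr (w y) (enn2real s))) (1 / enn2real s)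
          \<le> ennreal C * avg M (ball x r) w))}"


subsection \<open>Families of operators\<close>

definition trunc :: "'a set \<Rightarrow> ('a \<Rightarrow> 'b::real_normed_field) \<Rightarrow> 'a \<Rightarrow> 'b" where
  "trunc E f = (\<lambda>y. indicator E y * f y)"

(* A linear space of measurable scalar functions (the scalar field 'b being the real or the
   complex numbers) that is stable under truncation by measurable sets. *)
definition truncation_space :: "'a measure \<Rightarrow> ('a \<Rightarrow> 'b::real_normed_field) set \<Rightarrow> bool" where
  "truncation_space M D \<longleftrightarrow>
     D \<subseteq> borel_measurable M \<and>
     (\<lambda>_. 0) \<in> D \<and>
     (\<forall>f\<in>D. \<forall>g\<in>D. (\<lambda>y. f y + g y) \<in> D) \<and>
     (\<forall>f\<in>D. \<forall>c. (\<lambda>y. c * f y) \<in> D) \<and>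
     (\<forall>f\<in>D. \<forall>E\<in>sets M. trunc E f \<in> D)"

definition sublinear_op ::
    "'a measure \<Rightarrow> ('a \<Rightarrow> 'b::real_normed_field) set \<Rightarrow> (('a \<Rightarrow> 'b) \<Rightarrow> 'a \<Rightarrow> 'b) \<Rightarrow> bool" where
  "sublinear_op M D S \<longleftrightarrow>
     (\<forall>f\<in>D. S f \<in> borel_measurable M) \<and>
     (\<forall>f\<in>D. \<forall>g\<in>D. AE y in M. norm (S (\<lambda>z. f z + g z) y) \<le> norm (S f y) + norm (S g y)) \<and>
     (\<forall>f\<in>D. \<forall>c. AE y in M. norm (S (\<lambda>z. c * f z) y) = norm c * norm (S f y))"


subsection \<open>Off-diagonal estimates on balls\<close>

definition Upsilon :: "real \<Rightarrow> real" where
  "Upsilon s = max s (inverse s)"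

definition annulus :: "'a::metric_space \<Rightarrow> real \<Rightarrow> nat \<Rightarrow> 'a set" where
  "annulus x r j = ball x (2 ^ (j + 1) * r) - ball x (2 ^ j * r)"

(* ((1/N(B)) \<integral>_E |g|^p dN)^(1/p): integration over E, normalised by the measure of B,
   which may be a different set; for p = \<infinity> the essential supremum of |g| over E. *)
definition Lp_avg ::
    "'a measure \<Rightarrow> ennreal \<Rightarrow> 'a set \<Rightarrow> 'a set \<Rightarrow> ('a \<Rightarrow> 'b::real_normed_vector) \<Rightarrow> ennreal" where
  "Lp_avg N p B E g =
     (if p = \<infinity> then esssup N (\<lambda>y. ennreal (norm (g y)) * indicator E y)
      else enn_powr ((\<integral>\<^sup>+y\<in>E. ennreal (norm (g y) powr enn2real p) \<partial>N) / emeasure N B)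
                    (1 / enn2real p))"

(* L^p(N)-L^q(N) estimates for the family T on the function space D, where 1 \<le> p \<le> q \<le> \<infinity>. *)
definition off_diagonal_on_balls ::
    "'a::metric_space measure \<Rightarrow> ('a \<Rightarrow> 'b::real_normed_field) set \<Rightarrow>
     (real \<Rightarrow> ('a \<Rightarrow> 'b) \<Rightarrow> 'a \<Rightarrow> 'b) \<Rightarrow> ennreal \<Rightarrow> ennreal \<Rightarrow> bool" where
  "off_diagonal_on_balls N D T p q \<longleftrightarrow>
     (\<exists>\<theta>1>0. \<exists>\<theta>2>0. \<exists>c>0. \<exists>C>0. \<forall>t>0. \<forall>x. \<forall>r>0. \<forall>f\<in>D.
        Lp_avg N q (ball x r) (ball x r) (T t (trunc (ball x r) f))
          \<le> ennreal (C * Upsilon (r / sqrt t) powr \<theta>2) * Lp_avg N p (ball x r) (ball x r) f \<and>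
        (\<forall>j\<ge>2.
           Lp_avg N q (ball x r) (ball x r) (T t (trunc (annulus x r j) f))
             \<le> ennreal (C * 2 powr (real j * \<theta>1) * Upsilon (2 ^ j * r / sqrt t) powr \<theta>2
                          * exp (- (c * 4 ^ j * r\<^sup>2 / t)))
               * Lp_avg N p (ball x (2 ^ (j + 1) * r)) (annulus x r j) f \<and>
           Lp_avg N q (ball x (2 ^ (j + 1) * r)) (annulus x r j) (T t (trunc (ball x r) f))
             \<le> ennreal (C * 2 powr (real j * \<theta>1) * Upsilon (2 ^ j * r / sqrt t) powr \<theta>2
                          * exp (- (c * 4 ^ j * r\<^sup>2 / t)))
               * Lp_avg N p (ball x r) (ball x r) f))"

end

(* A weight w in A_{p/p0} and in RH_s with s = (q0/q)' satisfies these two conditions also for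
   slightly better exponents: w is in A_{p/p1} and in RH_{(q1/q)'} for some p0 < p1 < p and q < q1 < q0.
   By Hoelder's inequality, averages in L^q(w) are then bounded by averages in L^{q1}(mu) and averages
   in L^{p1}(mu) by averages in L^p(w), so that the L^{p1}(mu)-L^{q1}(mu) estimates give the
   L^p(w)-L^q(w) estimates with the same parameters theta_1, theta_2, c.

   The better exponents come from a reverse Hoelder inequality applied to w^(-1/(p/p0 - 1)) and w^s:
   in both cases the set of points of a ball where the weight is much smaller than its mean has small
   measure. A stopping-time argument with the Vitali covering lemma turns this into
   v({z in B. v z > h}) <= h mu({z in 2B. v z > c h}) for all heights h above a multiple of the mean of v
   over B; summing over dyadic heights bounds the mean of v^(1 + delta) over B by that over 2B with a
   small factor. *)
theory Submission
  imports Defs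
begin

subsection \<open>Vitali coverings and regularity of Borel measures\<close>

text \<open>Hoelder's inequality with the given exponents would lead exactly to \<open>p0\<close>
  and \<open>q0\<close>, where no estimate is assumed; this is why strictly better exponents are
  needed. Two obstacles shape their construction. A level set in a ball B is covered by balls that
  stick out of B, so the bound over B involves 2B and cannot be absorbed on a single ball; the
  absorption takes place in the supremum over all balls of the mean of v^(1 + \<delta>) divided by
  the (1 + \<delta>)-th power of the mean of v. This supremum must be known to be finite beforehand.
  The argument is therefore run for weights between two positive constants, with \<delta> and the
  final constant depending on \<beta> and \<open>C0\<close> only, and then carried over by
  truncation. The small factor is \<open>2 powr \<delta> - 1\<close>, the relative increment of a
  \<delta>-th power between consecutive dyadic heights. Since the level set inequality leaves room
  for constant factors, a differentiation statement with a loss suffices.\<close>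

lemma vitali_5r:
  fixes F :: "('a::metric_space \<times> real) set"
  assumes pos: "\<And>y s. (y, s) \<in> F \<Longrightarrow> 0 < s \<and> s \<le> R"
  obtains G where "G \<subseteq> F"
    and "disjoint_family_on (\<lambda>(y, s). ball y s) G"
    and "(\<Union>(y, s)\<in>F. ball y s) \<subseteq> (\<Union>(y, s)\<in>G. ball y (5 * s))"
proof -
  let ?b = "\<lambda>(y, s). ball (y::'a) s"
  \<comment> \<open>A selection that is maximal among those with the last property meets every ball of \<open>F\<close>:
    otherwise an unmet ball of nearly maximal radius could be added.\<close>
  define \<A> where "\<A> = {G. G \<subseteq> F \<and> disjoint_family_on ?b G \<and>
      (\<forall>f\<in>F. (\<exists>g\<in>G. ?b f \<inter> ?b g \<noteq> {}) \<longrightarrow> (\<exists>g\<in>G. ?b f \<inter> ?b g \<noteq> {} \<and> snd f < 2 * snd g))}"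
  have "{} \<in> \<A>" by (auto simp: \<A>_def disjoint_family_on_def)
  moreover have "\<Union>C \<in> \<A>" if "C \<noteq> {}" "subset.chain \<A> C" for C
  proof -
    have C: "C \<subseteq> \<A>" and lin: "\<And>X Y. X \<in> C \<Longrightarrow> Y \<in> C \<Longrightarrow> X \<subseteq> Y \<or> Y \<subseteq> X"
      using that by (auto simp: subset_chain_def)
    have "disjoint_family_on ?b (\<Union>C)"
      unfolding disjoint_family_on_def
    proof (intro ballI impI)
      fix m n assume "m \<in> \<Union>C" "n \<in> \<Union>C" "m \<noteq> n"
      then obtain X where "X \<in> C" "m \<in> X" "n \<in> X" using lin by blast
      then show "?b m \<inter> ?b n = {}"
        using C \<open>m \<noteq> n\<close> unfolding \<A>_def disjoint_family_on_def by blast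
    qed
    moreover have "\<exists>g\<in>\<Union>C. ?b f \<inter> ?b g \<noteq> {} \<and> snd f < 2 * snd g"
      if f: "f \<in> F" and ex: "\<exists>g\<in>\<Union>C. ?b f \<inter> ?b g \<noteq> {}" for f
    proof -
      obtain X where X: "X \<in> C" "\<exists>g\<in>X. ?b f \<inter> ?b g \<noteq> {}" using ex by blast
      then have "\<exists>g\<in>X. ?b f \<inter> ?b g \<noteq> {} \<and> snd f < 2 * snd g"
        using C f unfolding \<A>_def by blast
      then show ?thesis using X by blast
    qed
    ultimately show ?thesis using C unfolding \<A>_def by blast
  qed
  ultimately obtain G where G: "G \<in> \<A>" and max: "\<And>X. X \<in> \<A> \<Longrightarrow> G \<subseteq> X \<Longrightarrow> X = G"
    using subset_Zorn_nonempty[of \<A>] by blast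
  have hit: "\<exists>g\<in>G. ?b f \<inter> ?b g \<noteq> {}" if "f \<in> F" for f
  proof (rule ccontr)
    assume no: "\<not> ?thesis"
    define H where "H = {h\<in>F. \<forall>g\<in>G. ?b h \<inter> ?b g = {}}"
    have "f \<in> H" using that no by (auto simp: H_def)
    have bdd: "bdd_above (snd ` H)" using pos by (auto simp: H_def intro!: bdd_aboveI[of _ R])
    define S where "S = Sup (snd ` H)"
    have S: "snd h \<le> S" if "h \<in> H" for h using bdd that by (simp add: S_def cSUP_upper)
    have "0 < S" using S[OF \<open>f \<in> H\<close>] pos[of "fst f" "snd f"] that by auto
    then have "\<exists>h\<in>H. S / 2 < snd h"
      using less_cSUP_iff[OF _ bdd, of "S / 2"] \<open>f \<in> H\<close> by (auto simp: S_def)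
    then obtain h where h: "h \<in> H" "S < 2 * snd h" by auto
    have hb: "?b h \<noteq> {}" using h(1) pos by (cases h) (fastforce simp: H_def)
    have "insert h G \<in> \<A>"
    proof -
      have "\<exists>g\<in>insert h G. ?b k \<inter> ?b g \<noteq> {} \<and> snd k < 2 * snd g"
        if k: "k \<in> F" "\<exists>g\<in>insert h G. ?b k \<inter> ?b g \<noteq> {}" for k
      proof (cases "\<exists>g\<in>G. ?b k \<inter> ?b g \<noteq> {}")
        case True then show ?thesis using G k unfolding \<A>_def by blast
      next
        case False
        \<comment> \<open>A ball that meets only the new ball \<open>h\<close> belongs to
          \<open>H\<close>, so its radius is at most \<open>S\<close>, which is less than twice the
          radius of \<open>h\<close>.\<close>
        then have "k \<in> H" "?b k \<inter> ?b h \<noteq> {}" using k by (auto simp: H_def)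
        then show ?thesis using S[of k] h(2) by force
      qed
      moreover have "disjoint_family_on ?b (insert h G)"
      proof (subst disjoint_family_on_insert)
        show "h \<notin> G" using h(1) hb unfolding H_def by blast
        have "disjoint_family_on ?b G" using G unfolding \<A>_def by blast
        moreover have "\<forall>g\<in>G. ?b h \<inter> ?b g = {}" using h(1) unfolding H_def by blast
        ultimately show "?b h \<inter> \<Union> (?b ` G) = {} \<and> disjoint_family_on ?b G"
          by (simp only: Int_UN_distrib) simp
      qed
      moreover have "insert h G \<subseteq> F" using G h by (auto simp: \<A>_def H_def)
      ultimately show ?thesis unfolding \<A>_def by blast
    qed
    then have "h \<in> G" using max by blast
    then show False using h hb by (auto simp: H_def)
  qed
  show ?thesis
  proof (rule that)
    show "G \<subseteq> F" "disjoint_family_on ?b G" using G by (auto simp: \<A>_def)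
    show "(\<Union>(y, s)\<in>F. ball y s) \<subseteq> (\<Union>(y, s)\<in>G. ball y (5 * s))"
    proof clarify
      fix z y s assume f: "(y, s) \<in> F" and z: "z \<in> ball y s"
      obtain g where "g \<in> G" "?b (y, s) \<inter> ?b g \<noteq> {}" "snd (y, s) < 2 * snd g"
        using hit[OF f] G f unfolding \<A>_def by blast
      then obtain y' s' where g: "(y', s') \<in> G" "ball y s \<inter> ball y' s' \<noteq> {}" "s < 2 * s'"
        by (cases g) auto
      then obtain u where "dist y u < s" "dist y' u < s'" by auto
      \<comment> \<open>Through the common point \<open>u\<close>, the centre \<open>y'\<close> is
        within \<open>s' + s + s\<close> of \<open>z\<close>, and \<open>s < 2 * s'\<close>.\<close>
      then have "dist y' z < 5 * s'"
        using z g(3) dist_triangle[of y' z u] dist_triangle[of u z y] by (auto simp: dist_commute)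
      then show "z \<in> (\<Union>(y, s)\<in>G. ball y (5 * s))" using g by force
    qed
  qed
qed

text \<open>The Vitali selection is indexed by an arbitrary set, and separability is not assumed.
  Finite subfamilies have total measure at most that of \<open>U\<close>, so the measures are
  summable, and a summable family has only countably many nonzero terms.\<close>

lemma countable_disjoint_positive_measure:
  assumes meas: "\<And>i. i \<in> I \<Longrightarrow> B i \<in> sets M" and sub: "\<And>i. i \<in> I \<Longrightarrow> B i \<subseteq> U"
    and disj: "disjoint_family_on B I" and U: "U \<in> sets M" "emeasure M U < \<infinity>"
    and pos: "\<And>i. i \<in> I \<Longrightarrow> 0 < emeasure M (B i)"
  shows "countable I"
proof -
  have fin: "emeasure M (B i) \<noteq> \<infinity>" if "i \<in> I" for i
    using emeasure_mono[OF sub[OF that] U(1)] U(2) by (auto simp: top_unique)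
  have "sum (\<lambda>i. measure M (B i)) F \<le> measure M U" if F: "F \<subseteq> I" "finite F" for F
  proof -
    have "sum (\<lambda>i. measure M (B i)) F = measure M (\<Union>i\<in>F. B i)"
      using F meas fin disj
      by (intro measure_finite_Union[symmetric])
        (auto simp: disjoint_family_on_def subset_eq image_subset_iff)
    also have "\<dots> \<le> measure M U"
    proof (rule measure_mono_fmeasurable)
      show "(\<Union>i\<in>F. B i) \<subseteq> U" using F sub by blast
      show "(\<Union>i\<in>F. B i) \<in> sets M" using F meas by (intro sets.finite_UN) auto
      show "U \<in> fmeasurable M" using U by (auto simp: fmeasurable_def)
    qed
    finally show ?thesis .
  qed
  then have "(\<lambda>i. measure M (B i)) summable_on I"
    by (intro nonneg_bdd_above_summable_on) (auto intro!: bdd_aboveI)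
  then have "countable {i \<in> I. measure M (B i) \<noteq> 0}"
    using summable_countable_real by blast
  moreover have "{i \<in> I. measure M (B i) \<noteq> 0} = I"
    using fin pos by (auto simp: measure_def enn2real_eq_0_iff dest: less_imp_neq[THEN not_sym])
  ultimately show ?thesis by simp
qed

lemma emeasure_UN_countable_subadditive:
  assumes "countable I" and [measurable]: "\<And>i. i \<in> I \<Longrightarrow> X i \<in> sets M"
  shows "emeasure M (\<Union>i\<in>I. X i) \<le> (\<integral>\<^sup>+i. emeasure M (X i) \<partial>count_space I)"
proof -
  have [measurable]: "(\<Union>i\<in>I. X i) \<in> sets M" using assms by auto
  have "emeasure M (\<Union>i\<in>I. X i) = (\<integral>\<^sup>+x. indicator (\<Union>i\<in>I. X i) x \<partial>M)" by simp
  also have "\<dots> \<le> (\<integral>\<^sup>+x. \<integral>\<^sup>+i. indicator (X i) x \<partial>count_space I \<partial>M)"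
  proof (rule nn_integral_mono)
    fix x
    show "indicator (\<Union>i\<in>I. X i) x \<le> (\<integral>\<^sup>+i. indicator (X i) x \<partial>count_space I :: ennreal)"
    proof (cases "x \<in> (\<Union>i\<in>I. X i)")
      case True
      then obtain j where j: "j \<in> I" "x \<in> X j" by auto
      have "(1::ennreal) = (\<integral>\<^sup>+i. indicator {j} i \<partial>count_space I)"
        using j by (subst nn_integral_indicator) auto
      also have "\<dots> \<le> (\<integral>\<^sup>+i. indicator (X i) x \<partial>count_space I)"
        using j by (intro nn_integral_mono) (auto split: split_indicator)
      finally show ?thesis using True by simp
    qed simp
  qed
  also have "\<dots> = (\<integral>\<^sup>+i. emeasure M (X i) \<partial>count_space I)"
    by (subst nn_integral_count_space_nn_integral) (use assms in \<open>auto cong: nn_integral_cong_simp\<close>)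
  finally show ?thesis .
qed

text \<open>The bound on single balls passes to unions because the selected balls are disjoint, so
  that \<open>N2\<close> adds up over them, while their dilates cover everything for
  \<open>N1\<close>. The measure \<open>M\<close> makes the selection countable. The dilation 8
  replaces 5 because, as a power of two, it is reached by three doublings.\<close>

lemma vitali_measure_comparison:
  fixes F :: "('a::metric_space \<times> real) set"
  assumes radii: "\<And>y s. (y, s) \<in> F \<Longrightarrow> 0 < s \<and> s \<le> R"
    and borel: "sets M = sets borel" "sets N1 = sets borel" "sets N2 = sets borel"
    and pos: "\<And>y s. (y, s) \<in> F \<Longrightarrow> 0 < emeasure M (ball y s)"
    and U: "U \<in> sets borel" "emeasure M U < \<infinity>" "\<And>y s. (y, s) \<in> F \<Longrightarrow> ball y s \<subseteq> U"
    and le: "\<And>y s. (y, s) \<in> F \<Longrightarrow> emeasure N1 (ball y (8 * s)) \<le> K * emeasure N2 (ball y s)"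
  shows "emeasure N1 (\<Union>(y, s)\<in>F. ball y s) \<le> K * emeasure N2 (\<Union>(y, s)\<in>F. ball y s)"
proof -
  obtain G where G: "G \<subseteq> F" "disjoint_family_on (\<lambda>(y, s). ball y s) G"
    "(\<Union>(y, s)\<in>F. ball y s) \<subseteq> (\<Union>(y, s)\<in>G. ball y (5 * s))"
    using vitali_5r[of F R] radii by auto
  have cnt: "countable G"
  proof (rule countable_disjoint_positive_measure[where M = M and U = U and B = "\<lambda>(y, s). ball y s"])
    show "(case i of (y, s) \<Rightarrow> ball y s) \<subseteq> U" if "i \<in> G" for i
      using that G(1) U(3) by (cases i) (simp, blast)
    show "0 < emeasure M (case i of (y, s) \<Rightarrow> ball y s)" if "i \<in> G" for i
      using that G(1) pos by (cases i) (simp, blast)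
    show "U \<in> sets M" "emeasure M U < \<infinity>" using U borel by auto
    show "(case i of (y, s) \<Rightarrow> ball y s) \<in> sets M" for i
      unfolding borel by (cases i) auto
  qed (rule G(2))
  have "emeasure N1 (\<Union>(y, s)\<in>F. ball y s) \<le> emeasure N1 (\<Union>(y, s)\<in>G. ball y (8 * s))"
  proof (rule emeasure_mono)
    show "(\<Union>(y, s)\<in>F. ball y s) \<subseteq> (\<Union>(y, s)\<in>G. ball y (8 * s))"
    proof
      fix z assume "z \<in> (\<Union>(y, s)\<in>F. ball y s)"
      then obtain y s where "(y, s) \<in> G" "z \<in> ball y (5 * s)" using G(3) by force
      moreover then have "ball y (5 * s) \<subseteq> ball y (8 * s)"
        using G(1) radii[of y s] by (intro subset_ball) auto
      ultimately show "z \<in> (\<Union>(y, s)\<in>G. ball y (8 * s))" by blast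
    qed
    show "(\<Union>(y, s)\<in>G. ball y (8 * s)) \<in> sets N1"
      unfolding borel by (intro borel_open open_UN) auto
  qed
  also have "\<dots> \<le> (\<integral>\<^sup>+g. emeasure N1 (case g of (y, s) \<Rightarrow> ball y (8 * s)) \<partial>count_space G)"
    by (intro emeasure_UN_countable_subadditive cnt) (auto simp: borel)
  also have "\<dots> \<le> (\<integral>\<^sup>+g. K * emeasure N2 (case g of (y, s) \<Rightarrow> ball y s) \<partial>count_space G)"
    using G le by (intro nn_integral_mono) auto
  also have "\<dots> = K * (\<integral>\<^sup>+g. emeasure N2 (case g of (y, s) \<Rightarrow> ball y s) \<partial>count_space G)"
    by (intro nn_integral_cmult) auto
  also have "\<dots> = K * emeasure N2 (\<Union>(y, s)\<in>G. ball y s)"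
    using G by (subst emeasure_UN_countable[OF _ cnt]) (auto simp: borel)
  also have "\<dots> \<le> K * emeasure N2 (\<Union>(y, s)\<in>F. ball y s)"
    using G(1) by (intro mult_left_mono emeasure_mono) (auto simp: borel intro!: borel_open)
  finally show ?thesis .
qed

text \<open>Two-sided approximation is stable under complements, which exchange the closed and the
  open set, so induction on the generation of the sigma-algebra applies. Closed sets take the place
  of compact ones, as no completeness is assumed.\<close>

lemma finite_measure_regular_metric:
  fixes M :: "'a::metric_space measure"
  assumes fin: "finite_measure M" and sb: "sets M = sets borel"
    and A: "A \<in> sets borel" and e: "0 < e"
  shows "\<exists>K U. closed K \<and> open U \<and> K \<subseteq> A \<and> A \<subseteq> U \<and> measure M (U - K) < e"
proof -
  interpret finite_measure M by fact
  have [measurable_cong]: "sets M = sets borel" by fact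
  have [measurable (raw)]: "closed X \<Longrightarrow> X \<in> sets M" "open X \<Longrightarrow> X \<in> sets M" for X
    by (auto simp: sb)
  have "A \<in> sigma_sets UNIV {S. open S}" using A by (simp add: borel_def)
  then show ?thesis using e
  proof (induction arbitrary: e)
    case (Basic S)
    then have S: "open S" by simp
    \<comment> \<open>In a metric space an open set is the increasing union of the closed sets of
      points at distance at least \<open>1 / real (Suc n)\<close> from its complement. The whole
      space is treated apart, since \<open>infdist\<close> to the empty set is 0 by
      convention.\<close>
    define C where "C n = {x. 1 / real (Suc n) \<le> infdist x (- S)}" for n
    show ?case
    proof (cases "- S = {}")
      case True
      then have "S = UNIV" by auto
      then show ?thesis using Basic by (intro exI[of _ UNIV]) auto
    next
      case False
      have cl: "closed (C n)" for n
        unfolding C_def by (intro closed_Collect_le continuous_intros)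
      have C_sub: "C n \<subseteq> S" for n
      proof
        fix x assume "x \<in> C n"
        then have "infdist x (- S) > 0" unfolding C_def
          by (metis (mono_tags) divide_pos_pos less_le_trans mem_Collect_eq of_nat_0_less_iff zero_less_Suc zero_less_one)
        then show "x \<in> S" by (metis ComplI infdist_zero less_irrefl)
      qed
      have S_eq: "S = (\<Union>n. C n)"
      proof (intro equalityI subsetI)
        fix x assume "x \<in> S"
        then have "infdist x (- S) > 0"
          using S False by (intro infdist_pos_not_in_closed) (auto simp: closed_def)
        then obtain n where "1 / real (Suc n) < infdist x (- S)" using nat_approx_posE by metis
        then show "x \<in> (\<Union>n. C n)" by (auto simp: C_def intro!: exI[of _ n])
      qed (use C_sub in auto)
      have inc: "incseq C"
        unfolding C_def incseq_def
      proof (intro allI impI subsetI CollectI)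
        fix m n :: nat and x
        assume "m \<le> n" "x \<in> {x. 1 / real (Suc m) \<le> infdist x (- S)}"
        then show "1 / real (Suc n) \<le> infdist x (- S)"
          using frac_le[of 1 1 "real (Suc m)" "real (Suc n)"] by simp
      qed
      have "(\<lambda>n. measure M (C n)) \<longlonglongrightarrow> measure M S"
        unfolding S_eq using cl inc by (intro finite_Lim_measure_incseq) auto
      then have "\<forall>\<^sub>F n in sequentially. measure M (C n) > measure M S - e"
        using Basic.prems by (intro order_tendstoD) auto
      then obtain n where "measure M (C n) > measure M S - e"
        by (metis eventually_sequentially order_refl)
      then have "measure M (S - C n) < e"
        using finite_measure_Diff[of S "C n"] C_sub[of n] cl[of n] S by auto
      then show ?thesis using cl C_sub S by blast
    qed
  next
    case Empty
    then show ?case by (intro exI[of _ "{}"]) auto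
  next
    case (Compl A)
    then obtain K U where "closed K" "open U" "K \<subseteq> A" "A \<subseteq> U" "measure M (U - K) < e" by metis
    moreover have "- K - (- U) = U - K" by auto
    ultimately show ?case
      by (intro exI[of _ "- U"] exI[of _ "- K"]) (auto simp: closed_Compl open_Compl Compl_eq_Diff_UNIV[symmetric])
  next
    case (Union A)
    \<comment> \<open>One half of \<open>e\<close> is spent on the sets \<open>A i\<close>, with
      shares that sum to \<open>e / 2\<close>. The other half pays for keeping only finitely many of
      the \<open>K i\<close>, since an infinite union of closed sets need not be closed.\<close>
    have "\<forall>i. \<exists>K U. closed K \<and> open U \<and> K \<subseteq> A i \<and> A i \<subseteq> U \<and> measure M (U - K) < e / 2 * (1/2) ^ Suc i"
    proof
      fix i
      have "0 < e / 2 * (1/2) ^ Suc i" using Union.prems by simp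
      then show "\<exists>K U. closed K \<and> open U \<and> K \<subseteq> A i \<and> A i \<subseteq> U \<and> measure M (U - K) < e / 2 * (1/2) ^ Suc i"
        by (rule Union.IH)
    qed
    then obtain K U where KU: "\<And>i. closed (K i)" "\<And>i. open (U i)" "\<And>i. K i \<subseteq> A i" "\<And>i. A i \<subseteq> U i"
      "\<And>i. measure M (U i - K i) < e / 2 * (1/2) ^ Suc i" by metis
    define L where "L n = (\<Union>i<n. K i)" for n :: nat
    define V where "V = (\<Union>i. U i)"
    have clL: "closed (L n)" for n unfolding L_def using KU by auto
    have opV: "open V" unfolding V_def using KU by auto
    have meas: "V \<in> sets M" "\<And>n. L n \<in> sets M" "\<And>i. U i - K i \<in> sets M"
      using clL opV KU by auto
    have "(\<lambda>n. measure M (L n)) \<longlonglongrightarrow> measure M (\<Union>n. L n)"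
      using meas by (intro finite_Lim_measure_incseq) (fastforce simp: incseq_def L_def)+
    then have "\<forall>\<^sub>F n in sequentially. measure M (L n) > measure M (\<Union>n. L n) - e / 2"
      using Union.prems by (intro order_tendstoD) auto
    then obtain n where n: "measure M (L n) > measure M (\<Union>n. L n) - e / 2"
      by (metis eventually_sequentially order_refl)
    have sms: "(\<lambda>i. e / 2 * (1/2) ^ Suc i) sums (e / 2)"
      using sums_mult[OF power_half_series, of "e / 2"] by simp
    have "summable (\<lambda>i. measure M (U i - K i))"
      using KU(5) by (intro summable_comparison_test'[OF sums_summable[OF sms]]) (auto intro: less_imp_le)
    moreover have "V - (\<Union>n. L n) \<subseteq> (\<Union>i. U i - K i)" by (auto simp: V_def L_def)
    ultimately have "measure M (V - (\<Union>n. L n)) \<le> (\<Sum>i. measure M (U i - K i))"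
      using meas by (intro order_trans[OF finite_measure_mono finite_measure_subadditive_countably]) auto
    also have "\<dots> \<le> e / 2"
      using KU(5) sums_unique[OF sms] sums_summable[OF sms] \<open>summable _\<close>
      by (metis (no_types, lifting) suminf_le less_imp_le)
    finally have 1: "measure M (V - (\<Union>n. L n)) \<le> e / 2" .
    have LA: "L n \<subseteq> (\<Union>i. A i)" for n using KU(3) unfolding L_def by blast
    have AV: "(\<Union>i. A i) \<subseteq> V" using KU(4) unfolding V_def by blast
    have sub: "(\<Union>n. L n) \<subseteq> V" "L n \<subseteq> (\<Union>n. L n)" using LA AV by blast+
    have "measure M (V - L n) = measure M V - measure M (L n)"
      using meas sub by (intro finite_measure_Diff) auto
    also have "measure M V = measure M (V - (\<Union>n. L n)) + measure M (\<Union>n. L n)"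
      using meas sub by (subst finite_measure_Diff) auto
    finally have "measure M (V - L n) < e" using 1 n by linarith
    then show ?case
      by (intro exI[of _ "L n"] exI[of _ V] conjI clL opV LA AV)
  qed
qed

subsection \<open>Level sets of weights on spaces of homogeneous type\<close>

locale doubling_measure =
  fixes M :: "'a::metric_space measure" and C0 :: real
  assumes sets_M: "sets M = sets borel"
    and emeasure_ball_pos: "\<And>x r. 0 < r \<Longrightarrow> 0 < emeasure M (ball x r)"
    and emeasure_ball_finite: "\<And>x r. emeasure M (ball x r) < \<infinity>"
    and doubling: "\<And>x r. 0 < r \<Longrightarrow> measure M (ball x (2 * r)) \<le> C0 * measure M (ball x r)"
begin

abbreviation W :: "('a \<Rightarrow> real) \<Rightarrow> 'a measure"
  where "W v \<equiv> density M (\<lambda>y. ennreal (v y))"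

definition mean :: "('a \<Rightarrow> real) \<Rightarrow> 'a \<Rightarrow> real \<Rightarrow> real"
  where "mean v x r = measure (W v) (ball x r) / measure M (ball x r)"

definition positive_weight :: "('a \<Rightarrow> real) \<Rightarrow> bool" where
  "positive_weight v \<longleftrightarrow> v \<in> borel_measurable borel \<and> (\<forall>y. 0 \<le> v y) \<and>
     (\<forall>x. \<forall>r>0. 0 < emeasure (W v) (ball x r) \<and> emeasure (W v) (ball x r) < \<infinity>)"

text \<open>The threshold \<open>1 / (2 * C0)\<close> is small enough to make the weighted measure doubling as well.\<close>

definition A_infinity :: "real \<Rightarrow> ('a \<Rightarrow> real) \<Rightarrow> bool" where
  "A_infinity \<beta> v \<longleftrightarrow> positive_weight v \<and>
     (\<forall>x. \<forall>r>0. measure M {y\<in>ball x r. v y \<le> \<beta> * mean v x r} \<le> measure M (ball x r) / (2 * C0))"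

section \<open>Balls, weighted measures and means\<close>

lemma measure_ball_pos: "0 < r \<Longrightarrow> 0 < measure M (ball x r)"
  using emeasure_ball_pos[of r x] emeasure_ball_finite[of x r]
  by (simp add: measure_def enn2real_positive_iff)

lemma emeasure_ball_eq: "emeasure M (ball x r) = ennreal (measure M (ball x r))"
  using emeasure_ball_finite[of x r] by (intro emeasure_eq_ennreal_measure) auto

lemma borel_measurable_M: "f \<in> borel_measurable borel \<Longrightarrow> f \<in> borel_measurable M"
  using measurable_cong_sets[OF sets_M refl] by blast

lemma emeasure_finite_subset: "A \<subseteq> ball x r \<Longrightarrow> emeasure M A < \<infinity>"
  using emeasure_mono[of A "ball x r" M] emeasure_ball_finite[of x r] sets_M
  by (auto intro: le_less_trans)

lemma measure_mono_bounded:
  assumes "A \<subseteq> B" "B \<subseteq> ball x r" "A \<in> sets borel" "B \<in> sets borel"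
  shows "measure M A \<le> measure M B"
  using assms emeasure_finite_subset[of B x r] sets_M
  by (intro measure_mono_fmeasurable) (auto simp: fmeasurable_def)

lemma measure_ball_mono: "ball x r \<subseteq> ball y s \<Longrightarrow> measure M (ball x r) \<le> measure M (ball y s)"
  by (rule measure_mono_bounded[of _ _ y s]) auto

lemma one_le_C0: "1 \<le> C0"
proof -
  have "measure M (ball undefined 1) \<le> measure M (ball undefined 2)"
    by (intro measure_ball_mono subset_ball) simp
  also have "\<dots> \<le> C0 * measure M (ball undefined 1)"
    using doubling[of 1 undefined] by simp
  finally show ?thesis using measure_ball_pos[of 1 undefined] by simp
qed

lemma measure_ball_power: "0 < r \<Longrightarrow> measure M (ball x (2 ^ k * r)) \<le> C0 ^ k * measure M (ball x r)"
proof (induction k)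
  case (Suc k)
  have "measure M (ball x (2 * (2 ^ k * r))) \<le> C0 * measure M (ball x (2 ^ k * r))"
    using Suc by (intro doubling) simp
  also have "\<dots> \<le> C0 * (C0 ^ k * measure M (ball x r))"
    using Suc one_le_C0 by (intro mult_left_mono) auto
  finally show ?case by (simp add: mult.assoc)
qed simp

lemma positive_weightD:
  assumes "positive_weight v"
  shows "v \<in> borel_measurable borel" "v \<in> borel_measurable M" "0 \<le> v y"
    and "0 < r \<Longrightarrow> 0 < measure (W v) (ball x r)" "emeasure (W v) (ball x r) < \<infinity>"
    and "0 < r \<Longrightarrow> 0 < mean v x r"
    and "emeasure (W v) (ball x r) = ennreal (measure (W v) (ball x r))"
proof -
  show "v \<in> borel_measurable borel" "0 \<le> v y" using assms by (auto simp: positive_weight_def)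
  then show "v \<in> borel_measurable M" by (intro borel_measurable_M)
  show *: "emeasure (W v) (ball x r) < \<infinity>" for x r
    using assms by (cases "0 < r") (auto simp: positive_weight_def ball_empty)
  show **: "0 < measure (W v) (ball x r)" if "0 < r" for x r
    using assms *[of x r] that
    by (simp add: measure_def enn2real_positive_iff positive_weight_def)
  show "0 < r \<Longrightarrow> 0 < mean v x r"
    using **[of r x] measure_ball_pos[of r x] by (simp add: mean_def)
  show "emeasure (W v) (ball x r) = ennreal (measure (W v) (ball x r))"
    using *[of x r] by (intro emeasure_eq_ennreal_measure) auto
qed

lemma mean_eq: "0 < r \<Longrightarrow> measure (W v) (ball x r) = mean v x r * measure M (ball x r)"
  using measure_ball_pos[of r x] by (simp add: mean_def)

lemma W_mono_bounded:
  assumes "positive_weight v" "A \<subseteq> B" "B \<subseteq> ball x r" "A \<in> sets borel" "B \<in> sets borel"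
  shows "measure (W v) A \<le> measure (W v) B"
proof (rule measure_mono_fmeasurable)
  have "emeasure (W v) B \<le> emeasure (W v) (ball x r)"
    using assms sets_M by (intro emeasure_mono) auto
  then show "B \<in> fmeasurable (W v)"
    using assms positive_weightD(5)[OF assms(1), of x r] sets_M by (auto simp: fmeasurable_def)
qed (use assms sets_M in auto)

lemma W_lower_bound:
  assumes v: "positive_weight v" and E: "E \<in> sets borel" "E \<subseteq> ball x r"
    and c: "0 \<le> c" "\<And>y. y \<in> E \<Longrightarrow> c \<le> v y"
  shows "c * measure M E \<le> measure (W v) E"
proof -
  have EM: "E \<in> sets M" using E sets_M by simp
  have fin: "emeasure M E \<noteq> \<infinity>" "emeasure (W v) E \<noteq> \<infinity>"
    using emeasure_finite_subset[OF E(2)] emeasure_mono[OF E(2), of "W v"] sets_M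
      positive_weightD(5)[OF v, of x r] by (auto simp: top_unique)
  have "ennreal (c * measure M E) = ennreal c * emeasure M E"
    using fin c by (simp add: ennreal_mult emeasure_eq_ennreal_measure)
  also have "\<dots> = (\<integral>\<^sup>+y. ennreal c * indicator E y \<partial>M)"
    using EM by (simp add: nn_integral_cmult)
  also have "\<dots> \<le> (\<integral>\<^sup>+y. ennreal (v y) * indicator E y \<partial>M)"
    using c by (intro nn_integral_mono) (auto split: split_indicator intro: ennreal_leI)
  also have "\<dots> = emeasure (W v) E"
    using EM positive_weightD(2)[OF v] by (subst emeasure_density) auto
  also have "\<dots> = ennreal (measure (W v) E)" using fin by (simp add: emeasure_eq_ennreal_measure)
  finally show ?thesis by simp
qed

lemma measure_superlevel:
  assumes v: "positive_weight v" and r: "0 < r"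
    and le: "measure M {y\<in>ball x r. v y \<le> c} \<le> measure M (ball x r) / 2"
  shows "measure M (ball x r) / 2 \<le> measure M {y\<in>ball x r. c < v y}"
proof -
  have [measurable]: "v \<in> borel_measurable borel" using positive_weightD[OF v] by simp
  have s: "{y\<in>ball x r. v y \<le> c} \<in> sets borel" "{y\<in>ball x r. c < v y} \<in> sets borel"
    by measurable
  have "measure M (ball x r) = measure M ({y\<in>ball x r. v y \<le> c} \<union> {y\<in>ball x r. c < v y})"
    by (intro arg_cong[where f = "measure M"]) auto
  also have "\<dots> \<le> measure M {y\<in>ball x r. v y \<le> c} + measure M {y\<in>ball x r. c < v y}"
    using s sets_M emeasure_finite_subset[of _ x r]
    by (intro measure_Un_le) auto
  finally show ?thesis using le by simp
qed

text \<open>The part of \<open>ball x (2 * r)\<close> where \<open>v\<close> is at most \<beta>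
  times its mean has at most \<open>1 / (2 * C0)\<close> of the measure, hence fills at most half of
  \<open>ball x r\<close>. The other half alone bounds \<open>mean v x r\<close> from below.\<close>

lemma mean_doubling:
  assumes v: "A_infinity \<beta> v" and \<beta>: "0 < \<beta>" and r: "0 < r"
  shows "mean v x (2 * r) \<le> 2 / \<beta> * mean v x r"
proof -
  have pw: "positive_weight v" using v by (simp add: A_infinity_def)
  have [measurable]: "v \<in> borel_measurable borel" using positive_weightD[OF pw] by simp
  define m where "m = mean v x (2 * r)"
  have m: "0 < m" using positive_weightD(6)[OF pw] r by (simp add: m_def)
  have "measure M {y\<in>ball x r. v y \<le> \<beta> * m} \<le> measure M {y\<in>ball x (2 * r). v y \<le> \<beta> * m}"
  proof (rule measure_mono_bounded[of _ _ x "2 * r"])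
    show "{y\<in>ball x r. v y \<le> \<beta> * m} \<in> sets borel" "{y\<in>ball x (2 * r). v y \<le> \<beta> * m} \<in> sets borel"
      by measurable
  qed (use r in auto)
  also have "\<dots> \<le> measure M (ball x (2 * r)) / (2 * C0)"
    using v r by (simp add: A_infinity_def m_def)
  also have "\<dots> \<le> measure M (ball x r) / 2"
    using doubling[OF r, of x] one_le_C0 by (simp add: field_simps)
  finally have "measure M (ball x r) / 2 \<le> measure M {y\<in>ball x r. \<beta> * m < v y}"
    by (rule measure_superlevel[OF pw r])
  moreover have E: "{y\<in>ball x r. \<beta> * m < v y} \<in> sets borel" by measurable
  ultimately have "\<beta> * m * (measure M (ball x r) / 2) \<le> \<beta> * m * measure M {y\<in>ball x r. \<beta> * m < v y}"
    using \<beta> m by (intro mult_left_mono) auto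
  also have "\<dots> \<le> measure (W v) {y\<in>ball x r. \<beta> * m < v y}"
    using \<beta> m E by (intro W_lower_bound[OF pw, of _ x r]) (auto intro: less_imp_le)
  also have "\<dots> \<le> measure (W v) (ball x r)"
    by (intro W_mono_bounded[OF pw, of _ _ x r] E) auto
  also have "\<dots> = mean v x r * measure M (ball x r)" using r by (rule mean_eq)
  finally show ?thesis using measure_ball_pos[OF r, of x] \<beta> by (simp add: m_def field_simps)
qed

lemma mean_power:
  assumes v: "A_infinity \<beta> v" and \<beta>: "0 < \<beta>" and r: "0 < r"
  shows "mean v x (2 ^ k * r) \<le> (2 / \<beta>) ^ k * mean v x r"
proof (induction k)
  case (Suc k)
  have "mean v x (2 * (2 ^ k * r)) \<le> 2 / \<beta> * mean v x (2 ^ k * r)"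
    using r by (intro mean_doubling[OF v \<beta>]) simp
  also have "\<dots> \<le> 2 / \<beta> * ((2 / \<beta>) ^ k * mean v x r)"
    using Suc \<beta> by (intro mult_left_mono) auto
  finally show ?case by (simp add: mult.assoc)
qed simp

text \<open>Controls the means at the scales where a stopping argument inside the ball must end. All
  balls concerned lie in \<open>ball x (16 * r)\<close>, whose mean costs
  \<open>(2 / \<beta>) ^ 4\<close> by four doublings; \<open>ball y (32 * r)\<close> contains it,
  and five doublings from radius \<open>r\<close> give \<open>C0 ^ 5\<close>.\<close>

lemma mean_large_radius:
  assumes v: "A_infinity \<beta> v" and \<beta>: "0 < \<beta>" and y: "y \<in> ball x r" and s: "r < s" "s \<le> 8 * r"
  shows "mean v y s \<le> C0 ^ 5 * (2 / \<beta>) ^ 4 * mean v x r"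
proof -
  have r: "0 < r" using s by simp
  have pw: "positive_weight v" using v by (simp add: A_infinity_def)
  have sub: "ball y s \<subseteq> ball x (16 * r)" "ball x (16 * r) \<subseteq> ball y (32 * r)"
  proof -
    show "ball y s \<subseteq> ball x (16 * r)"
    proof
      fix z assume "z \<in> ball y s"
      then show "z \<in> ball x (16 * r)" using y s dist_triangle[of x z y] by simp
    qed
    show "ball x (16 * r) \<subseteq> ball y (32 * r)"
    proof
      fix z assume "z \<in> ball x (16 * r)"
      then show "z \<in> ball y (32 * r)" using y r dist_triangle[of y z x] by (simp add: dist_commute)
    qed
  qed
  have "measure M (ball x (16 * r)) \<le> measure M (ball y (32 * r))"
    by (intro measure_ball_mono sub)
  also have "\<dots> \<le> C0 ^ 5 * measure M (ball y r)" using measure_ball_power[OF r, of y 5] by simp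
  also have "\<dots> \<le> C0 ^ 5 * measure M (ball y s)"
    using s one_le_C0 by (intro mult_left_mono measure_ball_mono subset_ball) auto
  finally have 1: "measure M (ball x (16 * r)) \<le> C0 ^ 5 * measure M (ball y s)" .
  have p: "0 < measure M (ball y s)" "0 < measure M (ball x (16 * r))"
    using measure_ball_pos s r by simp_all
  have m: "0 \<le> mean v x (16 * r)" using positive_weightD(6)[OF pw, of "16 * r" x] r by simp
  have "mean v y s * measure M (ball y s) = measure (W v) (ball y s)" using s r by (simp add: mean_eq)
  also have "\<dots> \<le> measure (W v) (ball x (16 * r))"
    using sub by (intro W_mono_bounded[OF pw, of _ _ x "16 * r"]) auto
  also have "\<dots> = mean v x (16 * r) * measure M (ball x (16 * r))" using r by (simp add: mean_eq)
  also have "\<dots> \<le> mean v x (16 * r) * (C0 ^ 5 * measure M (ball y s))"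
    using m 1 by (intro mult_left_mono) auto
  finally have "mean v y s \<le> mean v x (16 * r) * C0 ^ 5"
    using p by (simp flip: mult.assoc)
  also have "\<dots> \<le> ((2 / \<beta>) ^ 4 * mean v x r) * C0 ^ 5"
    using mean_power[OF v \<beta> r, of x 4] one_le_C0 by (intro mult_right_mono) auto
  finally show ?thesis by (simp add: mult_ac)
qed

text \<open>A substitute for the Lebesgue differentiation theorem, with a loss of the factor \<open>2 * C0 ^ 3\<close>.\<close>

lemma weak_differentiation:
  assumes pw: "positive_weight v" and r: "0 < r" and h: "0 < h"
    and G: "G \<in> sets borel" "G \<subseteq> ball x r" "\<And>z. z \<in> G \<Longrightarrow> h < v z"
    and small: "\<And>z s. z \<in> G \<Longrightarrow> 0 < s \<Longrightarrow> s \<le> r \<Longrightarrow> mean v z s \<le> h / (2 * C0 ^ 3)"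
  shows "measure M G = 0"
proof (rule ccontr)
  assume "measure M G \<noteq> 0"
  then have mG: "0 < measure M G" by (simp add: zero_less_measure_iff)
  \<comment> \<open>Regularity is available for finite measures, so \<open>M\<close> is cut off to
    the ball that contains \<open>G\<close>.\<close>
  define M' where "M' = density M (indicator (ball x r))"
  have M': "emeasure M' A = emeasure M (A \<inter> ball x r)" if "A \<in> sets borel" for A
    unfolding M'_def using that sets_M by (subst emeasure_restricted) (auto simp: Int_commute)
  have "finite_measure M'"
    using M'[of UNIV] emeasure_ball_finite[of x r] sets_M
    by (intro finite_measureI) (auto simp: M'_def sets_eq_imp_space_eq)
  \<comment> \<open>The tolerance \<open>measure M G / 2\<close> yields an open \<open>V\<close>
    around \<open>G\<close> with less than 3/2 of its measure, which does not spoil the factor 1/2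
    gained below.\<close>
  then obtain K U where KU: "closed K" "open U" "K \<subseteq> G" "G \<subseteq> U" "measure M' (U - K) < measure M G / 2"
    using finite_measure_regular_metric[of M' G "measure M G / 2"] G mG sets_M by (auto simp: M'_def)
  define V where "V = U \<inter> ball x r"
  have V: "open V" "G \<subseteq> V" "V \<subseteq> ball x r" using KU G by (auto simp: V_def)
  have bs: "V \<in> sets borel" "K \<in> sets borel" using KU V by auto
  have "measure M' (U - K) = measure M (V - K)"
  proof -
    have "(U - K) \<inter> ball x r = V - K" by (auto simp: V_def)
    then show ?thesis using M'[of "U - K"] KU by (simp add: measure_def)
  qed
  moreover have "measure M (V - G) \<le> measure M (V - K)"
    using KU V G bs by (intro measure_mono_bounded[of _ _ x r]) auto
  moreover have "measure M V = measure M G + measure M (V - G)"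
    using V G emeasure_finite_subset[OF V(3)] bs sets_M
    by (subst measure_Diff) (auto dest: emeasure_finite_subset)
  ultimately have mV: "measure M V < 3 / 2 * measure M G" using KU(5) by linarith
  \<comment> \<open>The restriction \<open>8 * s \<le> r\<close> makes \<open>small\<close>
    applicable to the dilated ball. The \<open>C0 ^ 3\<close> lost in three doublings cancels the
    one in the threshold and leaves \<open>h / 2\<close>.\<close>
  define F where "F = {(z, s). z \<in> G \<and> 0 < s \<and> 8 * s \<le> r \<and> ball z s \<subseteq> V}"
  let ?O = "\<Union>(z, s)\<in>F. ball z s"
  have OV: "?O \<subseteq> V" by (auto simp: F_def)
  have GO: "G \<subseteq> ?O"
  proof
    fix z assume z: "z \<in> G"
    then obtain e where e: "0 < e" "ball z e \<subseteq> V" using V open_contains_ball by blast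
    have "ball z (min e (r / 8)) \<subseteq> V" using e by (auto simp: subset_eq)
    then have "(z, min e (r / 8)) \<in> F" using z e r by (auto simp: F_def)
    moreover have "z \<in> ball z (min e (r / 8))" using e r by simp
    ultimately show "z \<in> ?O" by blast
  qed
  have opO: "?O \<in> sets borel" by (intro borel_open open_UN) auto
  have "emeasure (W v) ?O \<le> ennreal (h / 2) * emeasure M ?O"
  proof (rule vitali_measure_comparison[where R = r and M = M and U = V])
    fix z s assume zs: "(z, s) \<in> F"
    then have s: "0 < s" "8 * s \<le> r" "z \<in> G" by (auto simp: F_def)
    have "measure (W v) (ball z (8 * s)) = mean v z (8 * s) * measure M (ball z (8 * s))"
      using s by (simp add: mean_eq)
    also have "\<dots> \<le> h / (2 * C0 ^ 3) * (C0 ^ 3 * measure M (ball z s))"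
      using s measure_ball_power[of s z 3] small[of z "8 * s"] h one_le_C0
      by (intro mult_mono) auto
    also have "\<dots> = h / 2 * measure M (ball z s)" using one_le_C0 by simp
    finally have "ennreal (measure (W v) (ball z (8 * s))) \<le> ennreal (h / 2 * measure M (ball z s))"
      by (rule ennreal_leI)
    then show "emeasure (W v) (ball z (8 * s)) \<le> ennreal (h / 2) * emeasure M (ball z s)"
      using h unfolding positive_weightD(7)[OF pw] emeasure_ball_eq
      by (simp only: ennreal_mult[symmetric] measure_nonneg divide_nonneg_pos less_imp_le zero_less_numeral)
  next
    show "0 < s \<and> s \<le> r" "ball z s \<subseteq> V" "0 < emeasure M (ball z s)" if "(z, s) \<in> F" for z s
      using that emeasure_ball_pos[of s z] by (auto simp: F_def)
    show "emeasure M V < \<infinity>" using V(3) by (rule emeasure_finite_subset)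
  qed (use sets_M bs in auto)
  also have "emeasure M ?O = ennreal (measure M ?O)"
    using emeasure_finite_subset[OF order_trans[OF OV V(3)]]
    by (intro emeasure_eq_ennreal_measure) (auto simp: less_top)
  also have "ennreal (h / 2) * ennreal (measure M ?O) = ennreal (h / 2 * measure M ?O)"
    using h by (intro ennreal_mult[symmetric]) auto
  finally have "measure (W v) ?O \<le> h / 2 * measure M ?O"
    unfolding measure_def[of "W v"] using h by (intro enn2real_leI) auto
  also have "\<dots> \<le> h / 2 * measure M V"
    using OV V opO bs h by (intro mult_left_mono measure_mono_bounded[of _ _ x r]) auto
  finally have 1: "measure (W v) ?O \<le> h / 2 * measure M V" .
  \<comment> \<open>The resulting chain makes \<open>h * measure M G\<close> less than 3/4 of
    itself.\<close>
  have "h * measure M G \<le> measure (W v) G"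
    using G h by (intro W_lower_bound[OF pw, of _ x r]) (auto intro: less_imp_le)
  also have "\<dots> \<le> measure (W v) ?O"
    using GO OV V opO G by (intro W_mono_bounded[OF pw, of _ _ x r]) auto
  also note 1
  also have "h / 2 * measure M V < h / 2 * (3 / 2 * measure M G)"
    using mV h by (intro mult_strict_left_mono) auto
  finally show False using h mG by simp
qed

text \<open>A stopping ball has mean above \<tau>, so \<open>v\<close> exceeds
  \<open>\<beta> * \<tau>\<close> on at least half of it, whereas the mean over its 8-fold dilate is
  at most \<tau>. Hence the weighted measure of the dilate is at most \<open>h\<close> times the
  measure of the part of the ball where \<open>v\<close> is large, and the covering lemma sums this
  over all stopping balls.\<close>

lemma level_set_estimate:
  assumes v: "A_infinity \<beta> v" and \<beta>: "0 < \<beta>" and r: "0 < r"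
    and h: "2 * C0 ^ 8 * (2 / \<beta>) ^ 4 * mean v x r \<le> h"
  shows "measure (W v) {z\<in>ball x r. h < v z}
    \<le> h * measure M {z\<in>ball x (2 * r). \<beta> / (2 * C0 ^ 3) * h < v z}"
proof -
  have pw: "positive_weight v" using v by (simp add: A_infinity_def)
  have [measurable]: "v \<in> borel_measurable borel" using positive_weightD[OF pw] by simp
  have C: "0 < C0" using one_le_C0 by simp
  have h0: "0 < h"
    using h positive_weightD(6)[OF pw r, of x] \<beta> C
    by (intro less_le_trans[OF _ h]) (auto intro!: mult_pos_pos divide_pos_pos)
  \<comment> \<open>The stopping level. In the lower bound on \<open>h\<close>,
    \<open>C0 ^ 8\<close> splits into \<open>C0 ^ 5\<close>, the cost in
    \<open>mean_large_radius\<close>, and \<open>C0 ^ 3\<close>, the divisor in \<tau>; so means at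
    radii between \<open>r\<close> and \<open>8 * r\<close> never exceed \<tau>.\<close>
  define \<tau> where "\<tau> = h / (2 * C0 ^ 3)"
  have \<tau>: "0 < \<tau>" "\<tau> * C0 ^ 3 = h / 2" using h0 C by (auto simp: \<tau>_def)
  have large: "mean v y s \<le> \<tau>" if "y \<in> ball x r" "r < s" "s \<le> 8 * r" for y s
  proof -
    have "mean v y s \<le> C0 ^ 5 * (2 / \<beta>) ^ 4 * mean v x r" using that by (rule mean_large_radius[OF v \<beta>])
    also have "\<dots> = 2 * C0 ^ 8 * (2 / \<beta>) ^ 4 * mean v x r / (2 * C0 ^ 3)"
    proof -
      have eq: "C0 ^ 8 = C0 ^ 5 * C0 ^ 3" by (simp flip: power_add)
      have aux: "a * q * m = 2 * (a * c) * q * m / (2 * c)" if "0 < c" for a c q m :: real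
        using that by simp
      show ?thesis unfolding eq by (rule aux) (use C in simp)
    qed
    also have "\<dots> \<le> \<tau>" unfolding \<tau>_def using h C by (intro divide_right_mono) auto
    finally show ?thesis .
  qed
  define F where "F = {(y, s). y \<in> ball x r \<and> 0 < s \<and> s \<le> r \<and> \<tau> < mean v y s \<and> mean v y (8 * s) \<le> \<tau>}"
  let ?O = "\<Union>(y, s)\<in>F. ball y s"
  \<comment> \<open>The radius is multiplied by 8 as long as it stays at most \<open>r\<close> and
    the mean stays above \<tau>. This ends since the radius grows, and then the mean at the next
    radius is at most \<tau>, by \<open>large\<close> if that radius exceeds
    \<open>r\<close>.\<close>
  have climb: "\<exists>s'\<ge>s. (y, s') \<in> F" if y: "y \<in> ball x r" and s: "0 < s" "s \<le> r" "\<tau> < mean v y s" for y s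
  proof -
    define P where "P k \<longleftrightarrow> 8 ^ k * s \<le> r \<and> \<tau> < mean v y (8 ^ k * s)" for k :: nat
    obtain n where "r / s < 8 ^ n" using real_arch_pow[of 8 "r / s"] by auto
    then have "\<not> P n" using s by (simp add: P_def field_simps)
    moreover have "P 0" using s by (simp add: P_def)
    ultimately obtain k where k: "P k" "\<not> P (Suc k)" by (metis nat_induct)
    define s' where "s' = 8 ^ k * s"
    have s': "s' \<le> r" "\<tau> < mean v y s'" "s \<le> s'"
      using k(1) s by (auto simp: P_def s'_def)
    have "mean v y (8 * s') \<le> \<tau>"
    proof (cases "8 * s' \<le> r")
      case True
      then show ?thesis using k(2) by (auto simp: P_def s'_def mult.assoc)
    next
      case False
      then show ?thesis using s' by (intro large y) auto
    qed
    then show ?thesis using s s' y by (auto simp: F_def)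
  qed
  define \<Omega> where "\<Omega> = {z\<in>ball x r. h < v z}"
  define S where "S = {z. \<beta> * \<tau> < v z}"
  have O: "?O \<in> sets borel" "?O \<subseteq> ball x (2 * r)"
  proof -
    show "?O \<in> sets borel" by (intro borel_open open_UN) auto
    show "?O \<subseteq> ball x (2 * r)"
    proof clarify
      fix y s z assume "(y, s) \<in> F" "z \<in> ball y s"
      then show "z \<in> ball x (2 * r)" using dist_triangle[of x z y] by (auto simp: F_def)
    qed
  qed
  have \<Omega>: "\<Omega> \<in> sets borel" and S: "S \<in> sets borel" unfolding \<Omega>_def S_def by measurable
  \<comment> \<open>At a point outside the stopping balls all means at radii up to \<open>r\<close>
    are at most \<tau>, which is exactly the threshold of the weak differentiation
    statement.\<close>
  have "measure M (\<Omega> - ?O) = 0"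
  proof (rule weak_differentiation[OF pw r h0])
    fix z s assume z: "z \<in> \<Omega> - ?O" and s: "0 < s" "s \<le> r"
    show "mean v z s \<le> h / (2 * C0 ^ 3)"
    proof (rule ccontr)
      assume "\<not> ?thesis"
      then obtain s' where s': "s \<le> s'" "(z, s') \<in> F"
        using climb[of z s] z s by (auto simp: \<tau>_def \<Omega>_def)
      then have "z \<in> ball z s'" using s by simp
      then show False using s' z by blast
    qed
  qed (use \<Omega> O in \<open>auto simp: \<Omega>_def\<close>)
  then have "emeasure M (\<Omega> - ?O) = 0"
  proof -
    have "\<Omega> - ?O \<subseteq> ball x r" by (auto simp: \<Omega>_def)
    then show ?thesis
      using emeasure_finite_subset \<open>measure M (\<Omega> - ?O) = 0\<close>
      by (subst emeasure_eq_ennreal_measure) (auto simp: less_top)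
  qed
  then have "\<Omega> - ?O \<in> null_sets M" using \<Omega> O sets_M by auto
  then have null: "\<Omega> - ?O \<in> null_sets (W v)"
    using positive_weightD(2)[OF pw] 
    by (intro absolutely_continuousI_density[unfolded absolutely_continuous_def, THEN subsetD]) auto
  \<comment> \<open>Restricting the measure to \<open>S\<close> lets the covering comparison count
    only the part of each stopping ball where \<open>v\<close> is large.\<close>
  have N2: "emeasure (density M (indicator S)) A = emeasure M (A \<inter> S)" if "A \<in> sets borel" for A
    using that S sets_M by (subst emeasure_restricted) (auto simp: Int_commute)
  have "emeasure (W v) ?O \<le> ennreal h * emeasure (density M (indicator S)) ?O"
  proof (rule vitali_measure_comparison[where R = r and M = M and U = "ball x (2 * r)"])
    fix y s assume ys: "(y, s) \<in> F"
    then have s: "0 < s" "mean v y (8 * s) \<le> \<tau>" "\<tau> < mean v y s" by (auto simp: F_def)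
    have "measure M {z\<in>ball y s. v z \<le> \<beta> * \<tau>} \<le> measure M {z\<in>ball y s. v z \<le> \<beta> * mean v y s}"
    proof (rule measure_mono_bounded[of _ _ y s])
      show "{z\<in>ball y s. v z \<le> \<beta> * \<tau>} \<subseteq> {z\<in>ball y s. v z \<le> \<beta> * mean v y s}"
        using s \<beta> by (auto elim!: order_trans)
      show "{z\<in>ball y s. v z \<le> \<beta> * \<tau>} \<in> sets borel" "{z\<in>ball y s. v z \<le> \<beta> * mean v y s} \<in> sets borel"
        by measurable
    qed auto
    also have "\<dots> \<le> measure M (ball y s) / (2 * C0)" using v s by (simp add: A_infinity_def)
    also have "\<dots> \<le> measure M (ball y s) / 2" using one_le_C0 by (intro divide_left_mono) auto
    finally have half: "measure M (ball y s) / 2 \<le> measure M {z\<in>ball y s. \<beta> * \<tau> < v z}"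
      by (rule measure_superlevel[OF pw s(1)])
    have "measure (W v) (ball y (8 * s)) = mean v y (8 * s) * measure M (ball y (8 * s))"
      using s by (simp add: mean_eq)
    also have "\<dots> \<le> \<tau> * (C0 ^ 3 * measure M (ball y s))"
      using s measure_ball_power[of s y 3] \<tau>(1) one_le_C0 by (intro mult_mono) auto
    also have "\<dots> = h * (measure M (ball y s) / 2)" using \<tau>(2) by (simp flip: mult.assoc)
    also have "\<dots> \<le> h * measure M {z\<in>ball y s. \<beta> * \<tau> < v z}"
      using half h0 by (intro mult_left_mono) auto
    also have "{z\<in>ball y s. \<beta> * \<tau> < v z} = ball y s \<inter> S" by (auto simp: S_def)
    finally have "ennreal (measure (W v) (ball y (8 * s))) \<le> ennreal (h * measure M (ball y s \<inter> S))"
      by (rule ennreal_leI)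
    also have "\<dots> = ennreal h * emeasure M (ball y s \<inter> S)"
      using h0 emeasure_finite_subset[of "ball y s \<inter> S" y s]
      by (simp add: ennreal_mult emeasure_eq_ennreal_measure)
    finally show "emeasure (W v) (ball y (8 * s)) \<le> ennreal h * emeasure (density M (indicator S)) (ball y s)"
      by (simp add: positive_weightD(7)[OF pw] N2)
  next
    show "0 < s \<and> s \<le> r" "0 < emeasure M (ball y s)" if "(y, s) \<in> F" for y s
      using that emeasure_ball_pos[of s y] by (auto simp: F_def)
    show "ball y s \<subseteq> ball x (2 * r)" if "(y, s) \<in> F" for y s using that O(2) by blast
    show "emeasure M (ball x (2 * r)) < \<infinity>" by (rule emeasure_ball_finite)
  qed (use sets_M in auto)
  also have "\<dots> = ennreal h * emeasure M (?O \<inter> S)" using O by (simp add: N2)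
  also have "\<dots> \<le> ennreal h * emeasure M (ball x (2 * r) \<inter> S)"
    using O S sets_M by (intro mult_left_mono emeasure_mono) auto
  finally have WO: "emeasure (W v) ?O \<le> ennreal h * emeasure M (ball x (2 * r) \<inter> S)" .
  have "emeasure (W v) \<Omega> \<le> emeasure (W v) (?O \<union> (\<Omega> - ?O))"
    using O \<Omega> sets_M by (intro emeasure_mono) auto
  also have "\<dots> = emeasure (W v) ?O" using null O sets_M by (intro emeasure_Un_null_set) auto
  also note WO
  also have "ennreal h * emeasure M (ball x (2 * r) \<inter> S) = ennreal (h * measure M (ball x (2 * r) \<inter> S))"
    using h0 emeasure_finite_subset[of "ball x (2 * r) \<inter> S" x "2 * r"]
    by (simp add: ennreal_mult emeasure_eq_ennreal_measure)
  finally have "measure (W v) \<Omega> \<le> h * measure M (ball x (2 * r) \<inter> S)"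
    unfolding measure_def[of "W v"] using h0 by (intro enn2real_leI) auto
  also have "ball x (2 * r) \<inter> S = {z\<in>ball x (2 * r). \<beta> / (2 * C0 ^ 3) * h < v z}"
    by (auto simp: S_def \<tau>_def mult_ac)
  finally show ?thesis by (simp add: \<Omega>_def)
qed

end

subsection \<open>The reverse Hoelder inequality\<close>

text \<open>A discrete layer-cake formula:
  \<open>(2 powr \<delta> - 1) * (h * 2 ^ k) powr \<delta>\<close> is the increment of the
  \<delta>-th power from one dyadic height to the next, so the sum telescopes up to the first height
  that is not below \<open>u\<close>. The prefactor tends to 0 with \<delta>, which later permits
  absorption.\<close>

lemma powr_le_dyadic_sum:
  fixes u h \<delta> :: real
  assumes h: "0 < h" and u: "0 < u" "u \<le> h * 2 ^ n" and \<delta>: "0 < \<delta>"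
  shows "u powr \<delta> \<le> h powr \<delta> + (2 powr \<delta> - 1) * (\<Sum>k<n. (h * 2 ^ k) powr \<delta> * of_bool (h * 2 ^ k < u))"
  using u(2)
proof (induction n)
  case 0
  then show ?case using u \<delta> by (simp add: powr_mono2)
next
  case (Suc n)
  have tele: "h powr \<delta> + (2 powr \<delta> - 1) * (\<Sum>k<m. (h * 2 ^ k) powr \<delta>) = (h * 2 ^ m) powr \<delta>" for m
  proof (induction m)
    case (Suc m)
    have "(h * 2 ^ Suc m) powr \<delta> = 2 powr \<delta> * (h * 2 ^ m) powr \<delta>"
      using h by (simp add: powr_mult mult_ac)
    then show ?case using Suc by (simp add: algebra_simps)
  qed simp
  show ?case
  proof (cases "u \<le> h * 2 ^ n")
    case True
    then show ?thesis using Suc.IH by simp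
  next
    case False
    have "h * 2 ^ k < u" if "k < Suc n" for k
    proof -
      have "h * 2 ^ k \<le> h * 2 ^ n" using that h by (intro mult_left_mono power_increasing) auto
      then show ?thesis using False by simp
    qed
    then have "(\<Sum>k<Suc n. (h * 2 ^ k) powr \<delta> * of_bool (h * 2 ^ k < u)) = (\<Sum>k<Suc n. (h * 2 ^ k) powr \<delta>)"
      by (intro sum.cong) auto
    then have "h powr \<delta> + (2 powr \<delta> - 1) * (\<Sum>k<Suc n. (h * 2 ^ k) powr \<delta> * of_bool (h * 2 ^ k < u))
        = (h * 2 ^ Suc n) powr \<delta>" using tele[of "Suc n"] by simp
    then show ?thesis using Suc.prems u \<delta> by (simp add: powr_mono2)
  qed
qed

text \<open>For \<open>1 \<le> a\<close> the terms at least double from one height to the next, so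
  the sum is at most twice its last nonzero term, uniformly in \<open>n\<close> and
  \<open>a\<close>.\<close>

lemma dyadic_sum_le_powr:
  fixes u h a :: real
  assumes h: "0 < h" and u: "0 < u" and a: "1 \<le> a"
  shows "(\<Sum>k<n. (h * 2 ^ k) powr a * of_bool (h * 2 ^ k < u)) \<le> 2 * u powr a"
proof (induction n)
  case (Suc n)
  have geo: "(\<Sum>k<m. (h * 2 ^ k) powr a) \<le> (h * 2 ^ m) powr a" for m
  proof (induction m)
    case (Suc m)
    have "2 * (h * 2 ^ m) powr a \<le> 2 powr a * (h * 2 ^ m) powr a"
      using a powr_mono[of 1 a 2] by (intro mult_right_mono) auto
    also have "\<dots> = (h * 2 ^ Suc m) powr a" using h by (simp add: powr_mult mult_ac)
    finally show ?case using Suc by simp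
  qed simp
  show ?case
  proof (cases "h * 2 ^ n < u")
    case False
    then show ?thesis using Suc by simp
  next
    case True
    have "(\<Sum>k<Suc n. (h * 2 ^ k) powr a * of_bool (h * 2 ^ k < u)) \<le> (\<Sum>k<Suc n. (h * 2 ^ k) powr a)"
      by (intro sum_mono) auto
    also have "\<dots> \<le> 2 * (h * 2 ^ n) powr a" using geo[of n] by simp
    also have "\<dots> \<le> 2 * u powr a" using True h a by (intro mult_left_mono powr_mono2) auto
    finally show ?thesis .
  qed
qed (use u in simp)

context doubling_measure
begin

lemma emeasure_W:
  assumes "v \<in> borel_measurable borel" "A \<in> sets borel"
  shows "emeasure (W v) A = (\<integral>\<^sup>+y. ennreal (v y) * indicator A y \<partial>M)"
  using assms sets_M borel_measurable_M[OF assms(1)] by (subst emeasure_density) auto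

lemma emeasure_density_zero [simp]: "emeasure (density M (\<lambda>_. 0)) A = 0"
  by (cases "A \<in> sets M") (auto simp: emeasure_density emeasure_notin_sets)

lemma W_upper_bound:
  assumes [measurable]: "u \<in> borel_measurable borel" "v \<in> borel_measurable borel" and A: "A \<in> sets borel"
    and c: "0 \<le> c" and v: "\<And>y. 0 \<le> v y" and le: "\<And>y. y \<in> A \<Longrightarrow> u y \<le> c + v y"
  shows "emeasure (W u) A \<le> ennreal c * emeasure M A + emeasure (W v) A"
proof -
  have AM: "A \<in> sets M" using A sets_M by simp
  have vM: "v \<in> borel_measurable M" by (intro borel_measurable_M) measurable
  have "emeasure (W u) A \<le> (\<integral>\<^sup>+y. ennreal c * indicator A y + ennreal (v y) * indicator A y \<partial>M)"
    unfolding emeasure_W[OF assms(1) A] using le v c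
    by (intro nn_integral_mono) (auto split: split_indicator simp flip: ennreal_plus intro!: ennreal_leI)
  also have "\<dots> = ennreal c * emeasure M A + emeasure (W v) A"
    unfolding emeasure_W[OF assms(2) A] using AM vM
    by (subst nn_integral_add) (auto simp: nn_integral_cmult)
  finally show ?thesis .
qed

lemma bounded_positive_weight:
  assumes v[measurable]: "v \<in> borel_measurable borel" and a: "0 < a" "\<And>y. a \<le> v y" "\<And>y. v y \<le> N"
  shows "positive_weight v"
  unfolding positive_weight_def
proof (intro conjI allI impI)
  show "0 \<le> v y" for y using a(1) a(2)[of y] by simp
  fix x and r :: real assume r: "0 < r"
  have bM: "ball x r \<in> sets M" using sets_M by simp
  have "0 < ennreal a * emeasure M (ball x r)"
    using a emeasure_ball_pos[OF r, of x] by (simp add: ennreal_zero_less_mult_iff)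
  also have "\<dots> = (\<integral>\<^sup>+y. ennreal a * indicator (ball x r) y \<partial>M)"
    using bM by (simp add: nn_integral_cmult)
  also have "\<dots> \<le> emeasure (W v) (ball x r)"
    unfolding emeasure_W[OF v borel_open[OF open_ball]] using a
    by (intro nn_integral_mono) (auto split: split_indicator intro: ennreal_leI)
  finally show "0 < emeasure (W v) (ball x r)" .
  have "0 \<le> N" using a(1) order_trans[OF a(2) a(3)] by (meson less_imp_le order_trans)
  then have "emeasure (W v) (ball x r) \<le> ennreal N * emeasure M (ball x r) + emeasure (W (\<lambda>_. 0)) (ball x r)"
    using a by (intro W_upper_bound) auto
  also have "\<dots> < \<infinity>"
    using emeasure_ball_finite[of x r] by (simp add: emeasure_W ennreal_mult_less_top)
  finally show "emeasure (W v) (ball x r) < \<infinity>" .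
qed (rule v)

text \<open>One dyadic sum distributes the excess of \<open>v powr (1 + \<delta>)\<close> over
  \<open>h powr \<delta> * v\<close> among superlevel sets, the level set estimate moves each of
  them to the doubled ball, and the other dyadic sum reassembles them there.\<close>

lemma integral_powr_estimate:
  fixes x :: 'a
  assumes v: "A_infinity \<beta> v" and \<beta>: "0 < \<beta>" and a: "0 < a" "\<And>y. a \<le> v y" "\<And>y. v y \<le> N"
    and \<delta>: "0 < \<delta>" and r: "0 < r"
  defines "b \<equiv> \<beta> / (2 * C0 ^ 3)" and "h \<equiv> 2 * C0 ^ 8 * (2 / \<beta>) ^ 4 * mean v x r"
  shows "measure (W (\<lambda>y. v y powr (1 + \<delta>))) (ball x r)
    \<le> h powr \<delta> * measure (W v) (ball x r)
      + (2 powr \<delta> - 1) * (2 * (1 / b) powr (1 + \<delta>) * measure (W (\<lambda>y. v y powr (1 + \<delta>))) (ball x (2 * r)))"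
proof -
  have pw: "positive_weight v" using v by (simp add: A_infinity_def)
  have [measurable]: "v \<in> borel_measurable borel" using positive_weightD[OF pw] by simp
  have C: "0 < C0" using one_le_C0 by simp
  have b: "0 < b" using \<beta> C by (simp add: b_def)
  have h: "0 < h"
    using positive_weightD(6)[OF pw r, of x] \<beta> C unfolding h_def
    by (intro mult_pos_pos zero_less_power divide_pos_pos) auto
  have vpos: "0 < v y" for y using a(1) a(2)[of y] by simp
  have pw': "positive_weight (\<lambda>y. v y powr (1 + \<delta>))"
    using a \<delta> vpos by (intro bounded_positive_weight[of _ "a powr (1 + \<delta>)" "N powr (1 + \<delta>)"])
      (auto intro!: powr_mono2 less_imp_le[OF vpos])
  \<comment> \<open>Boundedness of \<open>v\<close> makes finitely many dyadic heights sufficient,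
    so all sums are finite.\<close>
  obtain n where "N / h < 2 ^ n" using real_arch_pow[of 2 "N / h"] by auto
  then have n: "v y \<le> h * 2 ^ n" for y using a(3)[of y] h by (simp add: field_simps)
  define c where "c = 2 powr \<delta> - 1"
  have c: "0 \<le> c" using \<delta> by (simp add: c_def ge_one_powr_ge_zero)
  define hk where "hk k = h * 2 ^ k" for k :: nat
  have hk: "0 < hk k" "h \<le> hk k" for k using h by (auto simp: hk_def)
  let ?B = "ball x r" and ?B2 = "ball x (2 * r)"
  define \<Omega> where "\<Omega> k = {z\<in>?B. hk k < v z}" for k
  define \<Omega>' where "\<Omega>' k = {z\<in>?B2. b * hk k < v z}" for k
  have sets\<Omega>: "\<Omega> k \<in> sets borel" "\<Omega>' k \<in> sets borel" for k
    unfolding \<Omega>_def \<Omega>'_def by measurable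
  have sub: "\<Omega> k \<subseteq> ?B" "\<Omega>' k \<subseteq> ?B2" for k by (auto simp: \<Omega>_def \<Omega>'_def)
  have fin\<Omega>: "emeasure (W v) (\<Omega> k) = ennreal (measure (W v) (\<Omega> k))" for k
    using emeasure_mono[OF sub(1), of "W v" k] positive_weightD(5)[OF pw, of x r] sets_M
    by (intro emeasure_eq_ennreal_measure) (auto simp: top_unique)
  have fin\<Omega>': "emeasure M (\<Omega>' k) = ennreal (measure M (\<Omega>' k))" for k
    using emeasure_finite_subset[OF sub(2)] by (intro emeasure_eq_ennreal_measure) (auto simp: less_top)
  have vM: "v \<in> borel_measurable M" and indM: "\<And>S. S \<in> sets borel \<Longrightarrow> (indicator S :: 'a \<Rightarrow> ennreal) \<in> borel_measurable M"
    using positive_weightD(2)[OF pw] sets_M by auto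
  have 1: "measure (W (\<lambda>y. v y powr (1 + \<delta>))) ?B
      \<le> h powr \<delta> * measure (W v) ?B + (\<Sum>k<n. c * hk k powr \<delta> * measure (W v) (\<Omega> k))"
  proof -
    have "ennreal (measure (W (\<lambda>y. v y powr (1 + \<delta>))) ?B)
        = (\<integral>\<^sup>+y. ennreal (v y powr (1 + \<delta>)) * indicator ?B y \<partial>M)"
      unfolding positive_weightD(7)[OF pw', symmetric] by (rule emeasure_W) measurable
    also have "\<dots> \<le> (\<integral>\<^sup>+y. ennreal (h powr \<delta>) * (ennreal (v y) * indicator ?B y)
        + (\<Sum>k<n. ennreal (c * hk k powr \<delta>) * (ennreal (v y) * indicator (\<Omega> k) y)) \<partial>M)"
    proof (rule nn_integral_mono)
      fix y
      show "ennreal (v y powr (1 + \<delta>)) * indicator ?B y \<le> ennreal (h powr \<delta>) * (ennreal (v y) * indicator ?B y)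
        + (\<Sum>k<n. ennreal (c * hk k powr \<delta>) * (ennreal (v y) * indicator (\<Omega> k) y))"
      proof (cases "y \<in> ?B")
        case True
        have "v y powr (1 + \<delta>) = v y * v y powr \<delta>" using vpos[of y] by (simp add: powr_add)
        also have "\<dots> \<le> v y * (h powr \<delta> + c * (\<Sum>k<n. hk k powr \<delta> * of_bool (hk k < v y)))"
          unfolding c_def hk_def using vpos[of y] n[of y] h \<delta>
          by (intro mult_left_mono powr_le_dyadic_sum) auto
        also have "\<dots> = h powr \<delta> * v y + (\<Sum>k<n. c * hk k powr \<delta> * (v y * of_bool (hk k < v y)))"
          by (simp only: distrib_left sum_distrib_left mult_ac)
        finally have "ennreal (v y powr (1 + \<delta>)) \<le> ennreal \<dots>" by (rule ennreal_leI)
        also have "\<dots> = ennreal (h powr \<delta>) * ennreal (v y)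
            + (\<Sum>k<n. ennreal (c * hk k powr \<delta> * (v y * of_bool (hk k < v y))))"
          using vpos[of y] c
          by (subst ennreal_plus)
            (auto simp: ennreal_mult sum_ennreal[symmetric] intro!: sum_nonneg mult_nonneg_nonneg less_imp_le[OF vpos])
        also have "(\<Sum>k<n. ennreal (c * hk k powr \<delta> * (v y * of_bool (hk k < v y))))
            = (\<Sum>k<n. ennreal (c * hk k powr \<delta>) * (ennreal (v y) * indicator (\<Omega> k) y))"
          using True vpos[of y] c
          by (intro sum.cong) (auto simp: \<Omega>_def ennreal_mult indicator_def)
        finally show ?thesis using True by simp
      qed simp
    qed
    also have "\<dots> = ennreal (h powr \<delta>) * emeasure (W v) ?B
        + (\<Sum>k<n. ennreal (c * hk k powr \<delta>) * emeasure (W v) (\<Omega> k))"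
      using vM indM sets\<Omega>
      by (simp add: emeasure_W nn_integral_add nn_integral_sum nn_integral_cmult)
    also have "\<dots> = ennreal (h powr \<delta> * measure (W v) ?B + (\<Sum>k<n. c * hk k powr \<delta> * measure (W v) (\<Omega> k)))"
      unfolding fin\<Omega> positive_weightD(7)[OF pw] using c
      by (simp add: ennreal_mult[symmetric] sum_ennreal sum_nonneg)
    finally show ?thesis
      using c by (subst (asm) ennreal_le_iff) (auto intro!: add_nonneg_nonneg sum_nonneg)
  qed
  have 2: "(\<Sum>k<n. hk k powr (1 + \<delta>) * measure M (\<Omega>' k))
      \<le> 2 * (1 / b) powr (1 + \<delta>) * measure (W (\<lambda>y. v y powr (1 + \<delta>))) ?B2"
  proof -
    have "ennreal (\<Sum>k<n. hk k powr (1 + \<delta>) * measure M (\<Omega>' k))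
        = (\<Sum>k<n. ennreal (hk k powr (1 + \<delta>)) * emeasure M (\<Omega>' k))"
      unfolding fin\<Omega>' by (simp add: ennreal_mult[symmetric] sum_ennreal)
    also have "\<dots> = (\<integral>\<^sup>+y. (\<Sum>k<n. ennreal (hk k powr (1 + \<delta>)) * indicator (\<Omega>' k) y) \<partial>M)"
      using sets\<Omega> sets_M
      by (subst nn_integral_sum)
        (auto intro!: sum.cong borel_measurable_times borel_measurable_const borel_measurable_indicator
          simp: nn_integral_cmult_indicator)
    also have "\<dots> \<le> (\<integral>\<^sup>+y. ennreal (2 * (1 / b) powr (1 + \<delta>)) * (ennreal (v y powr (1 + \<delta>)) * indicator ?B2 y) \<partial>M)"
    proof (rule nn_integral_mono)
      fix y
      show "(\<Sum>k<n. ennreal (hk k powr (1 + \<delta>)) * indicator (\<Omega>' k) y)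
          \<le> ennreal (2 * (1 / b) powr (1 + \<delta>)) * (ennreal (v y powr (1 + \<delta>)) * indicator ?B2 y)"
      proof (cases "y \<in> ?B2")
        case True
        \<comment> \<open>On the doubled ball, membership in \<open>\<Omega>' k\<close> reads
          \<open>hk k < v y / b\<close>. The dyadic sum is thus taken at \<open>v y / b\<close>,
          which is where the power of \<open>1 / b\<close> comes from.\<close>
        have "(\<Sum>k<n. ennreal (hk k powr (1 + \<delta>)) * indicator (\<Omega>' k) y)
            = (\<Sum>k<n. ennreal (hk k powr (1 + \<delta>) * of_bool (hk k < v y / b)))"
          using True b by (intro sum.cong) (auto simp: \<Omega>'_def indicator_def field_simps)
        also have "\<dots> = ennreal (\<Sum>k<n. hk k powr (1 + \<delta>) * of_bool (hk k < v y / b))"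
          by (intro sum_ennreal) auto
        also have "\<dots> \<le> ennreal (2 * (v y / b) powr (1 + \<delta>))"
          unfolding hk_def using h vpos[of y] b \<delta> by (intro ennreal_leI dyadic_sum_le_powr) auto
        also have "(v y / b) powr (1 + \<delta>) = (1 / b) powr (1 + \<delta>) * v y powr (1 + \<delta>)"
          using vpos[of y] b by (simp add: powr_divide)
        finally show ?thesis using True by (simp add: ennreal_mult mult.assoc)
      next
        case False
        then have "y \<notin> \<Omega>' k" for k using sub(2) by blast
        then show ?thesis by simp
      qed
    qed
    also have "\<dots> = ennreal (2 * (1 / b) powr (1 + \<delta>)) * emeasure (W (\<lambda>y. v y powr (1 + \<delta>))) ?B2"
      using vM indM by (simp add: emeasure_W nn_integral_cmult)
    also have "\<dots> = ennreal (2 * (1 / b) powr (1 + \<delta>) * measure (W (\<lambda>y. v y powr (1 + \<delta>))) ?B2)"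
      unfolding positive_weightD(7)[OF pw'] by (simp add: ennreal_mult)
    finally show ?thesis by simp
  qed
  \<comment> \<open>The level set estimate trades weighted measure for a height times unweighted
    measure; the extra height raises the exponent from \<delta> to \<open>1 + \<delta>\<close>, as
    the second sum requires.\<close>
  have "(\<Sum>k<n. c * hk k powr \<delta> * measure (W v) (\<Omega> k)) \<le> (\<Sum>k<n. c * hk k powr \<delta> * (hk k * measure M (\<Omega>' k)))"
  proof (rule sum_mono)
    fix k
    have "measure (W v) (\<Omega> k) \<le> hk k * measure M (\<Omega>' k)"
      unfolding \<Omega>_def \<Omega>'_def b_def using hk(2)[of k]
      by (intro level_set_estimate[OF v \<beta> r]) (simp add: h_def)
    then show "c * hk k powr \<delta> * measure (W v) (\<Omega> k) \<le> c * hk k powr \<delta> * (hk k * measure M (\<Omega>' k))"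
      using c by (intro mult_left_mono) auto
  qed
  also have "\<dots> = c * (\<Sum>k<n. hk k powr (1 + \<delta>) * measure M (\<Omega>' k))"
    using hk(1) by (simp add: sum_distrib_left powr_add mult_ac less_imp_le)
  also have "\<dots> \<le> c * (2 * (1 / b) powr (1 + \<delta>) * measure (W (\<lambda>y. v y powr (1 + \<delta>))) ?B2)"
    using 2 c by (intro mult_left_mono) auto
  finally show ?thesis using 1 by (simp add: c_def)
qed

text \<open>For a weight bounded above and below, the best constant over all balls is finite and
  can therefore be absorbed; the resulting bound does not depend on the bounds of the weight.\<close>

lemma bounded_reverse_hoelder:
  assumes \<beta>: "0 < \<beta>" "\<beta> \<le> 1"
  shows "\<exists>\<delta>>0. \<exists>K>0. \<forall>v a N. A_infinity \<beta> v \<longrightarrow> 0 < a \<longrightarrow> (\<forall>y. a \<le> v y \<and> v y \<le> N) \<longrightarrow>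
    (\<forall>x. \<forall>r>0. mean (\<lambda>y. v y powr (1 + \<delta>)) x r \<le> K * mean v x r powr (1 + \<delta>))"
proof -
  have C: "1 \<le> C0" by (rule one_le_C0)
  define b where "b = \<beta> / (2 * C0 ^ 3)"
  define L where "L = 2 * C0 ^ 8 * (2 / \<beta>) ^ 4"
  have b: "0 < b" "b \<le> 1"
  proof -
    show "0 < b" using \<beta> C by (simp add: b_def)
    have "\<beta> \<le> 2 * C0 ^ 3" using \<beta> one_le_power[OF C, of 3] by linarith
    then show "b \<le> 1" using C by (simp add: b_def)
  qed
  have q: "1 \<le> 2 / \<beta>" using \<beta> by simp
  have L: "0 < L" using C \<beta> unfolding L_def by (intro mult_pos_pos zero_less_power divide_pos_pos) auto
  \<comment> \<open>Chosen to make the recursive term at most \<open>S / 2\<close>. As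
    \<open>\<delta> \<le> 1\<close> and the bases \<open>1 / b\<close> and
    \<open>2 / \<beta>\<close> are at least 1, their powers with exponent
    \<open>1 + \<delta>\<close> are bounded by squares, so \<kappa> can be fixed before
    \<delta>.\<close>
  define \<kappa> where "\<kappa> = 1 / (4 * (1 / b)\<^sup>2 * C0 * (2 / \<beta>)\<^sup>2)"
  have \<kappa>: "0 < \<kappa>" using b C \<beta> by (simp add: \<kappa>_def)
  define \<delta> where "\<delta> = min 1 (log 2 (1 + \<kappa>))"
  have \<delta>: "0 < \<delta>" "\<delta> \<le> 1" using \<kappa> by (auto simp: \<delta>_def)
  have "2 powr \<delta> \<le> 2 powr (log 2 (1 + \<kappa>))" by (intro powr_mono) (auto simp: \<delta>_def)
  then have 2: "2 powr \<delta> - 1 \<le> \<kappa>" using \<kappa> by simp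
  have ge0: "0 \<le> 2 powr \<delta> - 1" using \<delta> by (simp add: ge_one_powr_ge_zero)
  have p2: "z powr (1 + \<delta>) \<le> z\<^sup>2" if "1 \<le> z" for z :: real
    using powr_mono[of "1 + \<delta>" 2 z] that \<delta> by simp
  have main: "mean (\<lambda>y. v y powr (1 + \<delta>)) x r \<le> 2 * L powr \<delta> * mean v x r powr (1 + \<delta>)"
    if v: "A_infinity \<beta> v" and a: "0 < a" and aN: "\<And>y. a \<le> v y \<and> v y \<le> N" and r: "0 < r" for v a N x r
  proof -
    let ?v = "\<lambda>y. v y powr (1 + \<delta>)"
    have pw: "positive_weight v" using v by (simp add: A_infinity_def)
    have [measurable]: "v \<in> borel_measurable borel" using positive_weightD[OF pw] by simp
    have vpos: "0 < v y" for y using a aN[of y] by simp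
    have pw': "positive_weight ?v"
      using a \<delta> aN vpos by (intro bounded_positive_weight[of _ "a powr (1 + \<delta>)" "N powr (1 + \<delta>)"])
        (auto intro!: powr_mono2 less_imp_le[OF vpos])
    have mp: "0 < mean v x r" "0 < mean ?v x r" if "0 < r" for x r
      using that positive_weightD(6)[OF pw] positive_weightD(6)[OF pw'] by auto
    \<comment> \<open>The supremum of \<Phi> is the best constant in the inequality. The crude bound
      in terms of \<open>a\<close> and \<open>N\<close> merely makes it finite and does not enter
      the result.\<close>
    define \<Phi> where "\<Phi> = (\<lambda>(x, r). mean ?v x r / mean v x r powr (1 + \<delta>))"
    let ?P = "UNIV \<times> {0<..} :: ('a \<times> real) set"
    have "\<Phi> p \<le> N powr (1 + \<delta>) / a powr (1 + \<delta>)" if p_in: "p \<in> ?P" for p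
    proof -
      obtain x r where p: "p = (x, r)" "0 < r" using p_in by auto
      have "emeasure (W ?v) (ball x r) \<le> ennreal (N powr (1 + \<delta>)) * emeasure M (ball x r) + emeasure (W (\<lambda>_. 0)) (ball x r)"
        using aN \<delta> vpos by (intro W_upper_bound) (auto intro!: powr_mono2 less_imp_le[OF vpos])
      then have "measure (W ?v) (ball x r) \<le> N powr (1 + \<delta>) * measure M (ball x r)"
        unfolding positive_weightD(7)[OF pw'] emeasure_ball_eq
        by (simp add: emeasure_W ennreal_mult[symmetric])
      then have "mean ?v x r \<le> N powr (1 + \<delta>)"
        using measure_ball_pos[OF p(2), of x] by (simp add: mean_def divide_le_eq)
      moreover have "a \<le> mean v x r"
        using W_lower_bound[OF pw, of "ball x r" x r a] a aN measure_ball_pos[OF p(2), of x]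
        by (simp add: mean_def le_divide_eq)
      ultimately show ?thesis
        using a p \<delta> mp[OF p(2), of x] unfolding \<Phi>_def by (auto intro!: frac_le powr_mono2)
    qed
    then have bdd: "bdd_above (\<Phi> ` ?P)" by (intro bdd_aboveI) auto
    define S where "S = Sup (\<Phi> ` ?P)"
    have S: "mean ?v x r \<le> S * mean v x r powr (1 + \<delta>)" if "0 < r" for x r
    proof -
      have "\<Phi> (x, r) \<le> S" unfolding S_def using that by (intro cSUP_upper bdd) auto
      then show ?thesis using mp[OF that, of x] by (simp add: \<Phi>_def divide_le_eq)
    qed
    have "0 \<le> S * mean v x r powr (1 + \<delta>)" using S[OF r, of x] mp[OF r, of x] by linarith
    then have S0: "0 \<le> S" using mp[OF r, of x] by (simp add: zero_le_mult_iff)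
    \<comment> \<open>The mean over the doubled ball is estimated by \<open>S\<close> itself, at the
      price of the doubling constants of the mean and of the measure.\<close>
    have "\<Phi> p \<le> L powr \<delta> + S / 2" if p_in: "p \<in> ?P" for p
    proof -
      obtain x r where p: "p = (x, r)" and r: "0 < r" using p_in by auto
      let ?m = "mean v x r" and ?\<mu> = "measure M (ball x r)"
      note m = mp(1)[OF r, of x]
      have \<mu>: "0 < ?\<mu>" using r by (rule measure_ball_pos)
      have main: "mean ?v x r * ?\<mu> \<le> (L * ?m) powr \<delta> * (?m * ?\<mu>)
          + (2 powr \<delta> - 1) * (2 * (1 / b) powr (1 + \<delta>) * (mean ?v x (2 * r) * measure M (ball x (2 * r))))"
        using integral_powr_estimate[OF v \<beta>(1) a, of N \<delta> r x] aN \<delta> r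
        by (simp add: mean_eq L_def b_def)
      have eq: "(L * ?m) powr \<delta> * (?m * ?\<mu>) = L powr \<delta> * ?m powr (1 + \<delta>) * ?\<mu>"
        using L m by (simp add: powr_mult powr_add)
      have le: "mean ?v x (2 * r) * measure M (ball x (2 * r)) \<le> (S * ((2 / \<beta>)\<^sup>2 * ?m powr (1 + \<delta>))) * (C0 * ?\<mu>)"
      proof (rule mult_mono)
        have "mean ?v x (2 * r) \<le> S * mean v x (2 * r) powr (1 + \<delta>)" using r by (intro S) simp
        also have "\<dots> \<le> S * ((2 / \<beta> * ?m) powr (1 + \<delta>))"
          using mean_doubling[OF v \<beta>(1) r, of x] mp(1)[of "2 * r" x] r \<delta> S0
          by (intro mult_left_mono powr_mono2) auto
        also have "(2 / \<beta> * ?m) powr (1 + \<delta>) = (2 / \<beta>) powr (1 + \<delta>) * ?m powr (1 + \<delta>)"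
          by (rule powr_mult)
        also have "S * \<dots> \<le> S * ((2 / \<beta>)\<^sup>2 * ?m powr (1 + \<delta>))"
          using S0 p2[OF q] by (intro mult_left_mono mult_right_mono) auto
        finally show "mean ?v x (2 * r) \<le> S * ((2 / \<beta>)\<^sup>2 * ?m powr (1 + \<delta>))" .
      qed (use doubling[OF r, of x] S0 in auto)
      have "(2 powr \<delta> - 1) * (2 * (1 / b) powr (1 + \<delta>) * (mean ?v x (2 * r) * measure M (ball x (2 * r))))
          \<le> (2 powr \<delta> - 1) * (2 * (1 / b) powr (1 + \<delta>) * ((S * ((2 / \<beta>)\<^sup>2 * ?m powr (1 + \<delta>))) * (C0 * ?\<mu>)))"
        using le ge0 by (intro mult_left_mono) auto
      also have "(2 powr \<delta> - 1) * (2 * (1 / b) powr (1 + \<delta>) * ((S * ((2 / \<beta>)\<^sup>2 * ?m powr (1 + \<delta>))) * (C0 * ?\<mu>)))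
          \<le> \<kappa> * (2 * (1 / b)\<^sup>2 * ((S * ((2 / \<beta>)\<^sup>2 * ?m powr (1 + \<delta>))) * (C0 * ?\<mu>)))"
        using 2 ge0 \<kappa> S0 C p2[of "1 / b"] b by (intro mult_mono) auto
      also have "\<dots> = S / 2 * ?m powr (1 + \<delta>) * ?\<mu>"
        using b C \<beta> by (simp add: \<kappa>_def field_simps)
      finally have "mean ?v x r * ?\<mu> \<le> L powr \<delta> * ?m powr (1 + \<delta>) * ?\<mu> + S / 2 * ?m powr (1 + \<delta>) * ?\<mu>"
        using main eq by linarith
      then have "mean ?v x r * ?\<mu> \<le> ((L powr \<delta> + S / 2) * ?m powr (1 + \<delta>)) * ?\<mu>"
        by (simp add: distrib_right)
      then have "mean ?v x r \<le> (L powr \<delta> + S / 2) * ?m powr (1 + \<delta>)" using \<mu> by simp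
      then show ?thesis using m by (simp add: p \<Phi>_def divide_le_eq)
    qed
    then have "S \<le> L powr \<delta> + S / 2" unfolding S_def by (intro cSUP_least) auto
    then have "S \<le> 2 * L powr \<delta>" by simp
    then show ?thesis
      using S[OF r, of x] mult_right_mono[of S "2 * L powr \<delta>" "mean v x r powr (1 + \<delta>)"] by simp
  qed
  show ?thesis
  proof (rule exI[of _ \<delta>], rule conjI[OF \<delta>(1)], rule exI[of _ "2 * L powr \<delta>"], intro conjI allI impI)
    show "0 < 2 * L powr \<delta>" using L by simp
    fix v a N x and r :: real
    assume "A_infinity \<beta> v" "0 < a" "\<forall>y. a \<le> v y \<and> v y \<le> N" "0 < r"
    then show "mean (\<lambda>y. v y powr (1 + \<delta>)) x r \<le> 2 * L powr \<delta> * mean v x r powr (1 + \<delta>)"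
      using main[of v a N r x] by simp
  qed
qed

section \<open>Truncation of weights from below and above\<close>

lemma mean_upper_bound:
  assumes u: "positive_weight u" and v: "positive_weight v" and r: "0 < r"
    and c: "0 \<le> c" and le: "\<And>y. y \<in> ball x r \<Longrightarrow> u y \<le> c + v y"
  shows "mean u x r \<le> c + mean v x r"
proof -
  have "emeasure (W u) (ball x r) \<le> ennreal c * emeasure M (ball x r) + emeasure (W v) (ball x r)"
    using positive_weightD[OF u] positive_weightD[OF v] c le by (intro W_upper_bound) auto
  also have "\<dots> = ennreal (c * measure M (ball x r) + measure (W v) (ball x r))"
    unfolding emeasure_ball_eq positive_weightD(7)[OF v] using c by (simp add: ennreal_mult)
  finally have "measure (W u) (ball x r) \<le> c * measure M (ball x r) + measure (W v) (ball x r)"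
    unfolding positive_weightD(7)[OF u] using c by (subst (asm) ennreal_le_iff) auto
  then show ?thesis
    using measure_ball_pos[OF r, of x] by (simp add: mean_def field_simps)
qed

lemma mean_upper_bound_const:
  assumes u: "positive_weight u" and r: "0 < r"
    and c: "0 \<le> c" and le: "\<And>y. y \<in> ball x r \<Longrightarrow> u y \<le> c"
  shows "mean u x r \<le> c"
proof -
  have "emeasure (W u) (ball x r) \<le> ennreal c * emeasure M (ball x r) + emeasure (W (\<lambda>_. 0)) (ball x r)"
    using positive_weightD[OF u] c le by (intro W_upper_bound) auto
  also have "\<dots> = ennreal (c * measure M (ball x r))"
    unfolding emeasure_ball_eq using c by (simp add: ennreal_mult)
  finally have "measure (W u) (ball x r) \<le> c * measure M (ball x r)"
    unfolding positive_weightD(7)[OF u] using c by (subst (asm) ennreal_le_iff) auto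
  then show ?thesis
    using measure_ball_pos[OF r, of x] by (simp add: mean_def field_simps)
qed

lemma max_min_le_add:
  fixes a b c :: real
  assumes "0 \<le> a"
  shows "0 \<le> b \<Longrightarrow> max a (min b c) \<le> a + b" "0 \<le> c \<Longrightarrow> max a (min b c) \<le> a + c"
  using assms by (auto simp: max_def min_def)

lemma truncated_positive_weight:
  assumes v: "positive_weight v" and n: "1 \<le> n"
  shows "positive_weight (\<lambda>y. max (1 / n) (min (v y) n))"
proof -
  have [measurable]: "v \<in> borel_measurable borel" using positive_weightD[OF v] by simp
  have "1 / n \<le> n" using n by (simp add: field_simps) (metis mult_mono' mult_1 zero_le_one)
  then show ?thesis using n by (intro bounded_positive_weight[of _ "1 / n" n]) auto
qed

text \<open>Where the truncated weight is small relative to its mean, so is \<open>v\<close>: with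
  \<open>m\<close> the mean of \<open>v\<close>, the mean of the truncation is at most twice
  \<open>max (1 / n) (min m n)\<close>. The loss of a factor 2 is the same for every
  \<open>n\<close>, which is what makes a limit possible.\<close>

lemma A_infinity_truncated:
  assumes v: "A_infinity \<beta> v" and \<beta>: "0 < \<beta>" "\<beta> < 1" and n: "1 \<le> n"
  shows "A_infinity (\<beta> / 2) (\<lambda>y. max (1 / n) (min (v y) n))"
proof -
  let ?t = "\<lambda>y. max (1 / n) (min (v y) n)"
  have pw: "positive_weight v" using v by (simp add: A_infinity_def)
  have [measurable]: "v \<in> borel_measurable borel" using positive_weightD[OF pw] by simp
  have pt: "positive_weight ?t" using pw n by (rule truncated_positive_weight)
  have "measure M {y\<in>ball x r. ?t y \<le> \<beta> / 2 * mean ?t x r} \<le> measure M (ball x r) / (2 * C0)"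
    if r: "0 < r" for x r
  proof -
    let ?m = "mean v x r"
    have m: "0 < ?m" using r by (rule positive_weightD(6)[OF pw])
    have v0: "0 \<le> v y" for y by (rule positive_weightD(3)[OF pw])
    have "mean ?t x r \<le> 1 / n + ?m"
      using r n v0 by (intro mean_upper_bound[OF pt pw] max_min_le_add) auto
    moreover have "mean ?t x r \<le> 1 / n + n"
      using r n v0 by (intro mean_upper_bound_const[OF pt] max_min_le_add) auto
    ultimately have "mean ?t x r \<le> 2 * max (1 / n) (min ?m n)" by (auto simp: max_def min_def)
    then have mt: "\<beta> / 2 * mean ?t x r \<le> \<beta> * max (1 / n) (min ?m n)"
      using mult_left_mono[of "mean ?t x r" "2 * max (1 / n) (min ?m n)" "\<beta> / 2"] \<beta> by simp
    have "v y \<le> \<beta> * ?m" if y: "?t y \<le> \<beta> / 2 * mean ?t x r" for y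
    proof -
      have le: "?t y \<le> \<beta> * max (1 / n) (min ?m n)" using y mt by (rule order_trans)
      \<comment> \<open>As \<open>\<beta> < 1\<close>, the lower cut-off excludes values up to
        \<open>\<beta> * (1 / n)\<close>, and a value below \<open>n\<close> is not affected by the
        upper one; so \<open>v y\<close> is at most its truncated value.\<close>
      have "\<beta> * (1 / n) < 1 / n" using \<beta> n by (simp add: divide_strict_right_mono)
      then have *: "?t y \<le> \<beta> * min ?m n"
        using le by (cases "1 / n \<le> min ?m n") (auto simp: max_def split: if_splits)
      also have "\<dots> \<le> \<beta> * n" using \<beta> by (intro mult_left_mono) auto
      also have "\<dots> < n" using \<beta> n by simp
      finally have "v y = min (v y) n" by (auto simp: min_def split: if_splits)
      also have "\<dots> \<le> ?t y" by simp
      also note *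
      also have "\<beta> * min ?m n \<le> \<beta> * ?m" using \<beta> by (intro mult_left_mono) auto
      finally show ?thesis .
    qed
    then have "{y\<in>ball x r. ?t y \<le> \<beta> / 2 * mean ?t x r} \<subseteq> {y\<in>ball x r. v y \<le> \<beta> * ?m}" by blast
    moreover have "{y\<in>ball x r. ?t y \<le> \<beta> / 2 * mean ?t x r} \<in> sets borel"
      "{y\<in>ball x r. v y \<le> \<beta> * ?m} \<in> sets borel" by measurable
    ultimately have "measure M {y\<in>ball x r. ?t y \<le> \<beta> / 2 * mean ?t x r} \<le> measure M {y\<in>ball x r. v y \<le> \<beta> * ?m}"
      by (intro measure_mono_bounded[of _ _ x r]) auto
    also have "\<dots> \<le> measure M (ball x r) / (2 * C0)" using v r by (simp add: A_infinity_def)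
    finally show ?thesis .
  qed
  then show ?thesis using pt by (simp add: A_infinity_def)
qed

text \<open>The bounds for truncated weights are uniform in the truncation height, so monotone
  convergence carries them over. Truncation from below raises the mean by at most
  \<open>1 / n\<close>, hence at most doubles it for large \<open>n\<close>; this accounts for the
  factor \<open>2 powr (1 + \<delta>)\<close>.\<close>

theorem reverse_hoelder:
  assumes \<beta>: "0 < \<beta>" "\<beta> < 1"
  shows "\<exists>\<delta>>0. \<exists>K>0. \<forall>v. A_infinity \<beta> v \<longrightarrow> (\<forall>x. \<forall>r>0.
    (\<integral>\<^sup>+y\<in>ball x r. ennreal (v y powr (1 + \<delta>)) \<partial>M)
      \<le> ennreal (K * mean v x r powr (1 + \<delta>) * measure M (ball x r)))"
proof -
  obtain \<delta> K where \<delta>: "0 < \<delta>" and K: "0 < K"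
    and *: "\<forall>v a N. A_infinity (\<beta> / 2) v \<longrightarrow> 0 < a \<longrightarrow> (\<forall>y. a \<le> v y \<and> v y \<le> N) \<longrightarrow>
      (\<forall>x. \<forall>r>0. mean (\<lambda>y. v y powr (1 + \<delta>)) x r \<le> K * mean v x r powr (1 + \<delta>))"
  proof -
    have "0 < \<beta> / 2" "\<beta> / 2 \<le> 1" using \<beta> by auto
    from bounded_reverse_hoelder[OF this] show ?thesis by (elim exE conjE) (rule that)
  qed
  have bound: "mean (\<lambda>y. v y powr (1 + \<delta>)) x r \<le> K * mean v x r powr (1 + \<delta>)"
    if "A_infinity (\<beta> / 2) v" "0 < a" "\<And>y. a \<le> v y \<and> v y \<le> N" "0 < r" for v a N x r
    using * that by meson
  have "(\<integral>\<^sup>+y\<in>ball x r. ennreal (v y powr (1 + \<delta>)) \<partial>M)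
      \<le> ennreal (K * 2 powr (1 + \<delta>) * mean v x r powr (1 + \<delta>) * measure M (ball x r))"
    if v: "A_infinity \<beta> v" and r: "0 < r" for v x r
  proof -
    let ?m = "mean v x r" and ?\<mu> = "measure M (ball x r)"
    have pw: "positive_weight v" using v by (simp add: A_infinity_def)
    have [measurable]: "v \<in> borel_measurable borel" using positive_weightD[OF pw] by simp
    have v0: "0 \<le> v y" for y by (rule positive_weightD(3)[OF pw])
    have m: "0 < ?m" using r by (rule positive_weightD(6)[OF pw])
    have \<mu>: "0 < ?\<mu>" using r by (rule measure_ball_pos)
    \<comment> \<open>Starting above the reciprocal of the mean keeps the lower cut-off
      \<open>1 / n\<close> at most the mean.\<close>
    obtain n0 :: nat where n0: "max 1 (1 / ?m) < real n0" using reals_Archimedean2 by blast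
    \<comment> \<open>Cut off from above only, so that \<open>f\<close> increases with
      \<open>k\<close>. The lower cut-off decreases with \<open>k\<close> and enters through the
      comparison with \<open>?t\<close>.\<close>
    define f where "f k y = ennreal (min (v y) (real (n0 + k)) powr (1 + \<delta>)) * indicator (ball x r) y" for k y
    have [measurable]: "ball x r \<in> sets borel" by simp
    have fM: "f k \<in> borel_measurable M" for k
      unfolding f_def by (intro borel_measurable_M) measurable
    have inc: "incseq f"
      using v0 \<delta> unfolding f_def
      by (auto simp: incseq_def le_fun_def min_def split: split_indicator intro!: ennreal_leI powr_mono2)
    have fle: "(\<integral>\<^sup>+y. f k y \<partial>M) \<le> ennreal (K * 2 powr (1 + \<delta>) * ?m powr (1 + \<delta>) * ?\<mu>)" for k
    proof -
      define n where "n = real (n0 + k)"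
      have n: "1 \<le> n" "1 / n \<le> ?m"
      proof -
        have "real n0 \<le> n" by (simp add: n_def)
        then show "1 \<le> n" using n0 by simp
        have "1 / n \<le> 1 / real n0" using n0 \<open>real n0 \<le> n\<close> by (intro frac_le) auto
        also have "\<dots> \<le> ?m" using n0 m by (simp add: field_simps)
        finally show "1 / n \<le> ?m" .
      qed
      let ?t = "\<lambda>y. max (1 / n) (min (v y) n)"
      have n': "1 / n \<le> n" using n by (simp add: field_simps) (metis mult_mono' mult_1 zero_le_one)
      have pt: "positive_weight ?t" using pw n by (intro truncated_positive_weight)
      have pt': "positive_weight (\<lambda>y. ?t y powr (1 + \<delta>))"
        using n n' \<delta>
        by (intro bounded_positive_weight[of _ "(1 / n) powr (1 + \<delta>)" "n powr (1 + \<delta>)"])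
          (auto intro!: powr_mono2 simp: le_max_iff_disj)
      have "mean (\<lambda>y. ?t y powr (1 + \<delta>)) x r \<le> K * mean ?t x r powr (1 + \<delta>)"
        using n n' r by (intro bound[of _ "1 / n" n] A_infinity_truncated[OF v \<beta>]) auto
      also have "mean ?t x r \<le> 1 / n + ?m"
        using r n v0 by (intro mean_upper_bound[OF pt pw] max_min_le_add) auto
      then have "K * mean ?t x r powr (1 + \<delta>) \<le> K * (2 * ?m) powr (1 + \<delta>)"
        using K \<delta> n(2) positive_weightD(6)[OF pt r, of x]
        by (intro mult_left_mono powr_mono2) auto
      finally have mt: "mean (\<lambda>y. ?t y powr (1 + \<delta>)) x r \<le> K * (2 powr (1 + \<delta>) * ?m powr (1 + \<delta>))"
        by (simp only: powr_mult)
      have "(\<integral>\<^sup>+y. f k y \<partial>M) \<le> (\<integral>\<^sup>+y. ennreal (?t y powr (1 + \<delta>)) * indicator (ball x r) y \<partial>M)"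
        using v0 \<delta> n unfolding f_def n_def[symmetric]
        by (intro nn_integral_mono) (auto split: split_indicator intro!: ennreal_leI powr_mono2)
      also have "\<dots> = ennreal (measure (W (\<lambda>y. ?t y powr (1 + \<delta>))) (ball x r))"
        unfolding positive_weightD(7)[OF pt', symmetric] by (rule emeasure_W[symmetric]) measurable
      also have "\<dots> = ennreal (mean (\<lambda>y. ?t y powr (1 + \<delta>)) x r * ?\<mu>)" using r by (simp only: mean_eq)
      also have "\<dots> \<le> ennreal (K * (2 powr (1 + \<delta>) * ?m powr (1 + \<delta>)) * ?\<mu>)"
        using mt \<mu> by (intro ennreal_leI mult_right_mono) auto
      finally show ?thesis by (simp only: mult.assoc)
    qed
    have "(\<integral>\<^sup>+y. ennreal (v y powr (1 + \<delta>)) * indicator (ball x r) y \<partial>M) = (\<integral>\<^sup>+y. (SUP k. f k y) \<partial>M)"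
    proof (rule nn_integral_cong)
      fix y
      show "ennreal (v y powr (1 + \<delta>)) * indicator (ball x r) y = (SUP k. f k y)"
      proof (rule antisym)
        obtain k :: nat where "v y \<le> real k" using real_arch_simple by blast
        then have "min (v y) (real (n0 + k)) = v y" by simp
        then have "ennreal (v y powr (1 + \<delta>)) * indicator (ball x r) y = f k y" by (simp only: f_def)
        then show "ennreal (v y powr (1 + \<delta>)) * indicator (ball x r) y \<le> (SUP k. f k y)"
          by (intro SUP_upper2[of k]) simp_all
        show "(SUP k. f k y) \<le> ennreal (v y powr (1 + \<delta>)) * indicator (ball x r) y"
          using v0 \<delta> unfolding f_def
          by (intro SUP_least) (auto split: split_indicator intro!: ennreal_leI powr_mono2)
      qed
    qed
    also have "\<dots> = (SUP k. (\<integral>\<^sup>+y. f k y \<partial>M))"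
      using inc fM by (rule nn_integral_monotone_convergence_SUP)
    also have "\<dots> \<le> ennreal (K * 2 powr (1 + \<delta>) * ?m powr (1 + \<delta>) * ?\<mu>)"
      by (intro SUP_least fle)
    finally show ?thesis .
  qed
  moreover have "0 < K * 2 powr (1 + \<delta>)" using K by simp
  ultimately show ?thesis
    by - (rule exI[of _ \<delta>], rule conjI[OF \<delta>], rule exI[of _ "K * 2 powr (1 + \<delta>)"], simp)
qed

text \<open>Where \<open>u\<close> is at most \<beta> times its mean, the dual weight is at least
  \<open>(\<beta> * mean u x r) powr (- \<alpha>)\<close>. Chebyshev's inequality for \<sigma>
  therefore bounds this set by the fraction \<open>(\<beta> * A) powr \<alpha>\<close> of the ball,
  and \<beta> is chosen to make that at most \<open>1 / (2 * C0)\<close>. Exchanging the two weights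
  replaces \<alpha> by \<open>1 / \<alpha>\<close>, so the lemma serves a weight and its dual
  alike.\<close>

lemma A_infinity_of_dual:
  assumes u: "positive_weight u" and \<sigma>: "positive_weight \<sigma>" and \<alpha>: "0 < \<alpha>" and A: "0 < A"
    and dual: "AE y in M. 0 < u y \<and> \<sigma> y = u y powr (- \<alpha>)"
    and le: "\<And>x r. 0 < r \<Longrightarrow> mean u x r * mean \<sigma> x r powr (1 / \<alpha>) \<le> A"
  shows "\<exists>\<beta>>0. \<beta> < 1 \<and> A_infinity \<beta> u"
proof -
  have C: "0 < C0" using one_le_C0 by simp
  have [measurable]: "u \<in> borel_measurable borel" "\<sigma> \<in> borel_measurable borel"
    using positive_weightD[OF u] positive_weightD[OF \<sigma>] by auto
  define \<beta> where "\<beta> = min (1 / 2) ((1 / (2 * C0)) powr (1 / \<alpha>) / A)"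
  have \<beta>: "0 < \<beta>" "\<beta> < 1" using A C by (auto simp: \<beta>_def)
  have "\<beta> * A \<le> (1 / (2 * C0)) powr (1 / \<alpha>)" using A by (auto simp: \<beta>_def min_def field_simps)
  then have "(\<beta> * A) powr \<alpha> \<le> ((1 / (2 * C0)) powr (1 / \<alpha>)) powr \<alpha>"
    using \<beta> A \<alpha> by (intro powr_mono2) auto
  also have "\<dots> = 1 / (2 * C0)" using \<alpha> C by (simp add: powr_powr)
  finally have \<beta>A: "(\<beta> * A) powr \<alpha> \<le> 1 / (2 * C0)" .
  have "measure M {y\<in>ball x r. u y \<le> \<beta> * mean u x r} \<le> measure M (ball x r) / (2 * C0)" if r: "0 < r" for x r
  proof -
    let ?m = "mean u x r" and ?s = "mean \<sigma> x r"
    have pos: "0 < ?m" "0 < ?s" using r positive_weightD(6)[OF u] positive_weightD(6)[OF \<sigma>] by auto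
    let ?E = "{y\<in>ball x r. u y \<le> \<beta> * ?m}"
    let ?E' = "{y\<in>ball x r. u y \<le> \<beta> * ?m \<and> 0 < u y \<and> \<sigma> y = u y powr (- \<alpha>)}"
    have sets: "?E \<in> sets borel" "?E' \<in> sets borel" by measurable
    have "measure M ?E = measure M ?E'"
      using sets sets_M dual by (intro measure_eq_AE) auto
    moreover have "(\<beta> * ?m) powr (- \<alpha>) * measure M ?E' \<le> measure (W \<sigma>) ?E'"
    proof (rule W_lower_bound[OF \<sigma> sets(2)])
      fix y assume "y \<in> ?E'"
      then show "(\<beta> * ?m) powr (- \<alpha>) \<le> \<sigma> y" using \<alpha> by (auto intro!: powr_mono2')
    qed auto
    moreover have "measure (W \<sigma>) ?E' \<le> measure (W \<sigma>) (ball x r)"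
      using sets by (intro W_mono_bounded[OF \<sigma>, of _ _ x r]) auto
    ultimately have "(\<beta> * ?m) powr (- \<alpha>) * measure M ?E \<le> ?s * measure M (ball x r)"
      using r by (simp add: mean_eq)
    then have "measure M ?E \<le> (\<beta> * ?m) powr \<alpha> * ?s * measure M (ball x r)"
      using \<beta> pos by (simp add: powr_minus field_simps)
    also have "(\<beta> * ?m) powr \<alpha> * ?s = (\<beta> * (?m * ?s powr (1 / \<alpha>))) powr \<alpha>"
      using \<alpha> pos by (simp add: powr_mult powr_powr)
    also have "\<dots> \<le> (\<beta> * A) powr \<alpha>"
      using le[OF r, of x] \<beta> pos \<alpha> by (intro powr_mono2 mult_left_mono) auto
    also have "\<dots> \<le> 1 / (2 * C0)" by (rule \<beta>A)
    finally show ?thesis by (simp add: mult_right_mono)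
  qed
  then show ?thesis using \<beta> u by (intro exI[of _ \<beta>]) (simp add: A_infinity_def)
qed

text \<open>By \<open>le\<close> the mean of \<open>u powr s\<close> is at most a constant times the
  power of the mean of \<open>u\<close>, so a point where \<open>u powr s\<close> is small relative
  to its mean is one where \<open>u\<close> is.\<close>

lemma A_infinity_powr:
  assumes u: "A_infinity \<beta> u" and us: "positive_weight (\<lambda>y. u y powr s)" and s: "1 \<le> s" and \<beta>: "0 < \<beta>"
    and R: "1 \<le> R" and le: "\<And>x r. 0 < r \<Longrightarrow> mean (\<lambda>y. u y powr s) x r \<le> (R * mean u x r) powr s"
  shows "A_infinity ((\<beta> / R) powr s) (\<lambda>y. u y powr s)"
proof -
  have pw: "positive_weight u" using u by (simp add: A_infinity_def)
  have [measurable]: "u \<in> borel_measurable borel" using positive_weightD[OF pw] by simp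
  have "measure M {y\<in>ball x r. u y powr s \<le> (\<beta> / R) powr s * mean (\<lambda>y. u y powr s) x r}
      \<le> measure M (ball x r) / (2 * C0)" if r: "0 < r" for x r
  proof -
    have m: "0 < mean u x r" using r by (rule positive_weightD(6)[OF pw])
    have "u y \<le> \<beta> * mean u x r" if "u y powr s \<le> (\<beta> / R) powr s * mean (\<lambda>y. u y powr s) x r" for y
    proof -
      note that
      also have "(\<beta> / R) powr s * mean (\<lambda>y. u y powr s) x r \<le> (\<beta> / R) powr s * (R * mean u x r) powr s"
        using le[OF r] by (intro mult_left_mono) auto
      also have "\<dots> = (\<beta> / R * (R * mean u x r)) powr s" by (rule powr_mult[symmetric])
      also have "\<beta> / R * (R * mean u x r) = \<beta> * mean u x r" using R by simp
      finally show ?thesis using s \<beta> m powr_less_mono2[of s "\<beta> * mean u x r" "u y"] by force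
    qed
    then have "{y\<in>ball x r. u y powr s \<le> (\<beta> / R) powr s * mean (\<lambda>y. u y powr s) x r}
        \<subseteq> {y\<in>ball x r. u y \<le> \<beta> * mean u x r}" by blast
    moreover have "{y\<in>ball x r. u y powr s \<le> (\<beta> / R) powr s * mean (\<lambda>y. u y powr s) x r} \<in> sets borel"
      "{y\<in>ball x r. u y \<le> \<beta> * mean u x r} \<in> sets borel" by measurable
    ultimately have "measure M {y\<in>ball x r. u y powr s \<le> (\<beta> / R) powr s * mean (\<lambda>y. u y powr s) x r}
        \<le> measure M {y\<in>ball x r. u y \<le> \<beta> * mean u x r}"
      by (intro measure_mono_bounded[of _ _ x r]) auto
    also have "\<dots> \<le> measure M (ball x r) / (2 * C0)" using u r by (simp add: A_infinity_def)
    finally show ?thesis .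
  qed
  then show ?thesis using us by (simp add: A_infinity_def)
qed

end

subsection \<open>Muckenhoupt and reverse Hoelder classes\<close>

text \<open>Positivity of balls comes from doubling and the nonzero total measure: a null ball would
  have null dilates by powers of two, and these exhaust the space.\<close>

lemma homogeneous_type_doubling_measure:
  assumes "homogeneous_type M"
  obtains C0 where "doubling_measure M C0"
proof -
  obtain C :: real where sets: "sets M = sets borel" and nz: "emeasure M UNIV \<noteq> 0"
    and C: "\<And>x r. 0 < r \<Longrightarrow> emeasure M (ball x (2 * r)) \<le> ennreal C * emeasure M (ball x r)"
    and fin: "\<And>x r. 0 < r \<Longrightarrow> emeasure M (ball x r) < \<infinity>"
    using assms unfolding homogeneous_type_def by blast
  have fin': "emeasure M (ball x r) < \<infinity>" for x r
    using fin[of r x] by (cases "0 < r") (auto simp: ball_empty)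
  have "doubling_measure M (max 0 C)"
  proof
    fix x and r :: real assume r: "0 < r"
    show "0 < emeasure M (ball x r)"
    proof (rule ccontr)
      assume "\<not> ?thesis"
      then have z: "emeasure M (ball x r) = 0" by simp
      have "emeasure M (ball x (2 ^ k * r)) = 0" for k
      proof (induction k)
        case (Suc k)
        then show ?case using C[of "2 ^ k * r" x] r by (simp add: mult.assoc)
      qed (simp add: z)
      then have "emeasure M (\<Union>k. ball x (2 ^ k * r)) = 0"
        using sets by (intro emeasure_UN_eq_0) auto
      moreover have "(\<Union>k. ball x (2 ^ k * r)) = UNIV"
      proof (intro equalityI subsetI)
        fix y
        obtain k where "dist x y / r < 2 ^ k" using real_arch_pow[of 2 "dist x y / r"] by auto
        then show "y \<in> (\<Union>k. ball x (2 ^ k * r))" using r by (auto simp: field_simps)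
      qed auto
      ultimately show False using nz by simp
    qed
    have "ennreal (measure M (ball x (2 * r))) \<le> ennreal C * ennreal (measure M (ball x r))"
      using C[OF r, of x] fin'[of x] by (simp add: emeasure_eq_ennreal_measure less_top)
    also have "\<dots> \<le> ennreal (max 0 C) * ennreal (measure M (ball x r))"
      by (intro mult_right_mono ennreal_leI) auto
    also have "\<dots> = ennreal (max 0 C * measure M (ball x r))" by (simp add: ennreal_mult)
    finally show "measure M (ball x (2 * r)) \<le> max 0 C * measure M (ball x r)" by (simp add: ennreal_le_iff)
  qed (use sets fin' in auto)
  then show ?thesis by (rule that)
qed

section \<open>Powers of extended nonnegative reals\<close>

lemma enn_powr_ennreal_nonneg: "0 < a \<Longrightarrow> 0 \<le> u \<Longrightarrow> enn_powr (ennreal u) a = ennreal (u powr a)"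
  by (simp add: enn_powr_def)

lemma enn_powr_ennreal_neg:
  "a < 0 \<Longrightarrow> 0 \<le> u \<Longrightarrow> enn_powr (ennreal u) a = (if u = 0 then \<infinity> else ennreal (u powr a))"
  by (simp add: enn_powr_def)

lemma enn_powr_top: "0 < a \<Longrightarrow> enn_powr top a = top"
  by (simp add: enn_powr_def)

lemma enn_powr_mono:
  assumes "x \<le> y" "0 < a"
  shows "enn_powr x a \<le> enn_powr y a"
  using assms
  by (cases x; cases y) (auto simp: enn_powr_def top_unique intro!: ennreal_leI powr_mono2)

lemma conj_exp_ennreal:
  assumes "1 < P"
  shows "conj_exp (ennreal P) = ennreal (P / (P - 1))"
proof -
  have "ennreal P - 1 = ennreal (P - 1)" using ennreal_minus[of 1 P] by simp
  then show ?thesis using assms by (simp add: conj_exp_def divide_ennreal)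
qed

lemma UN_balls: "(\<Union>n::nat. ball x (real n)) = UNIV"
  using reals_Archimedean2 by auto

context doubling_measure
begin

lemma AE_from_balls:
  assumes "\<And>x r. 0 < r \<Longrightarrow> AE y in M. y \<in> ball x r \<longrightarrow> P y"
  shows "AE y in M. P y"
proof -
  have "AE y in M. \<forall>n::nat. y \<in> ball undefined (real n) \<longrightarrow> P y"
  proof (subst AE_all_countable, rule allI)
    fix n :: nat
    show "AE y in M. y \<in> ball undefined (real n) \<longrightarrow> P y"
      using assms[of "real n" undefined] by (cases "n = 0") auto
  qed
  then show ?thesis
  proof (rule AE_mp, intro AE_I2 impI)
    fix y assume "\<forall>n::nat. y \<in> ball undefined (real n) \<longrightarrow> P y"
    moreover have "y \<in> (\<Union>n::nat. ball undefined (real n))"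
      by (simp only: UN_balls UNIV_I)
    ultimately show "P y" by blast
  qed
qed

lemma avg_eq_mean:
  assumes "v \<in> borel_measurable borel" "emeasure (W v) (ball x r) < \<infinity>" "0 < r"
  shows "avg M (ball x r) (\<lambda>y. ennreal (v y)) = ennreal (mean v x r)"
proof -
  have "(\<integral>\<^sup>+y\<in>ball x r. ennreal (v y) \<partial>M) = emeasure (W v) (ball x r)"
    using assms by (simp add: emeasure_W)
  also have "\<dots> = ennreal (measure (W v) (ball x r))"
    using assms by (intro emeasure_eq_ennreal_measure) auto
  finally show ?thesis
    using measure_ball_pos[OF assms(3), of x]
    by (simp add: avg_def mean_def emeasure_ball_eq divide_ennreal)
qed

lemma emeasure_W_ball_pos:
  assumes v: "v \<in> borel_measurable borel" and r: "0 < r"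
    and pos: "AE y in M. y \<in> ball x r \<longrightarrow> 0 < v y"
  shows "0 < emeasure (W v) (ball x r)"
proof (rule ccontr)
  have bM: "ball x r \<in> sets M" using sets_M by simp
  assume "\<not> ?thesis"
  then have "(\<integral>\<^sup>+y. ennreal (v y) * indicator (ball x r) y \<partial>M) = 0"
    using v by (simp add: emeasure_W)
  then have "AE y in M. ennreal (v y) * indicator (ball x r) y = 0"
    using borel_measurable_M[OF v] bM by (subst (asm) nn_integral_0_iff_AE) auto
  then have "AE y in M. y \<notin> ball x r"
    using pos by eventually_elim (auto simp: ennreal_eq_0_iff split: split_indicator_asm)
  then have "ball x r \<in> null_sets M" using bM by (simp add: AE_iff_null_sets)
  then show False using emeasure_ball_pos[OF r, of x] by auto
qed

lemma weight_finite:
  assumes "weight M w"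
  shows "w \<in> borel_measurable borel" "0 \<le> w y" "emeasure (W w) (ball x r) < \<infinity>"
proof -
  have "w \<in> borel_measurable M" using assms by (simp add: weight_def)
  then show m: "w \<in> borel_measurable borel" using measurable_cong_sets[OF sets_M refl] by blast
  show nn: "0 \<le> w y" for y using assms by (simp add: weight_def)
  show "emeasure (W w) (ball x r) < \<infinity>"
  proof (cases "0 < r")
    case True
    then have "integrable M (\<lambda>y. indicator (ball x r) y * w y)"
      using assms by (simp add: weight_def set_integrable_def)
    then have "(\<integral>\<^sup>+y. ennreal (norm (indicator (ball x r) y * w y)) \<partial>M) < \<infinity>"
      by (simp add: integrable_iff_bounded)
    also have "(\<integral>\<^sup>+y. ennreal (norm (indicator (ball x r) y * w y)) \<partial>M) = emeasure (W w) (ball x r)"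
      unfolding emeasure_W[OF m borel_open[OF open_ball]] using nn
      by (intro nn_integral_cong) (auto split: split_indicator)
    finally show ?thesis .
  qed (simp add: ball_empty)
qed

text \<open>The infinite value of a negative power at 0 yields a zero-one law: if \<open>w\<close>
  has positive mass on a ball, the A_p bound makes the integral of the dual power finite there, so
  \<open>w\<close> is positive almost everywhere on it, and larger balls carry this to the whole
  space. The hypothesis \<open>nz\<close> excludes weights that vanish almost everywhere, which
  satisfy the condition through \<open>0 * \<infinity> = 0\<close>.\<close>

lemma Ap_dual_weight:
  assumes w: "w \<in> Ap M (ennreal P)" and P: "1 < P" and nz: "emeasure (W w) (ball x1 r1) \<noteq> 0"
  defines "\<alpha> \<equiv> 1 / (P - 1)"
  shows "positive_weight w" "positive_weight (\<lambda>y. w y powr (- \<alpha>))" "AE y in M. 0 < w y"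
    and "\<exists>A>0. \<forall>x. \<forall>r>0. mean w x r * mean (\<lambda>y. w y powr (- \<alpha>)) x r powr (1 / \<alpha>) \<le> A"
proof -
  have \<alpha>: "0 < \<alpha>" using P by (simp add: \<alpha>_def)
  have wt: "weight M w" using w by (simp add: Ap_def)
  note [measurable] = weight_finite(1)[OF wt]
  have w0: "0 \<le> w y" for y by (rule weight_finite(2)[OF wt])
  \<comment> \<open>The dual weight in two versions: \<open>?S\<close> is infinite where
    \<open>w\<close> vanishes, while the real power \<open>?\<sigma>\<close> is 0 there. Only
    \<open>?S\<close> detects zeros of \<open>w\<close>; both agree almost everywhere once
    \<open>w\<close> is known to be positive.\<close>
  let ?\<sigma> = "\<lambda>y. w y powr (- \<alpha>)"
  let ?S = "\<lambda>y. enn_powr (ennreal (w y)) (- \<alpha>)"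
  have S: "?S y = (if w y = 0 then \<infinity> else ennreal (?\<sigma> y))" for y
    using w0[of y] \<alpha> by (simp add: enn_powr_ennreal_neg)
  have ex: "1 - enn2real (conj_exp (ennreal P)) = - \<alpha>" "enn2real (ennreal P) - 1 = 1 / \<alpha>"
    using P by (auto simp: conj_exp_ennreal \<alpha>_def field_simps)
  obtain A0 where A0: "\<And>x r. 0 < r \<Longrightarrow> avg M (ball x r) (\<lambda>y. ennreal (w y)) *
      enn_powr (avg M (ball x r) ?S) (1 / \<alpha>) \<le> ennreal A0"
    using w unfolding Ap_def ex by blast
  have SM: "?S \<in> borel_measurable M" unfolding S by (intro borel_measurable_M) measurable
  have fin: "(\<integral>\<^sup>+y\<in>ball x r. ?S y \<partial>M) < \<infinity>"
    if r: "0 < r" and pos: "emeasure (W w) (ball x r) \<noteq> 0" for x r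
  proof (rule ccontr)
    assume "\<not> ?thesis"
    then have "avg M (ball x r) ?S = \<infinity>"
      using emeasure_ball_finite[of x r] by (simp add: avg_def ennreal_top_divide less_top[symmetric])
    moreover have "avg M (ball x r) (\<lambda>y. ennreal (w y)) \<noteq> 0"
      using pos emeasure_ball_finite[of x r] by (auto simp: avg_def emeasure_W)
    ultimately show False
      using A0[OF r, of x] \<alpha> by (simp add: enn_powr_top ennreal_mult_top top_unique)
  qed
  have AE_ball: "AE y in M. y \<in> ball x r \<longrightarrow> 0 < w y"
    if r: "0 < r" and pos: "emeasure (W w) (ball x r) \<noteq> 0" for x r
  proof -
    have "AE y in M. ?S y * indicator (ball x r) y \<noteq> \<infinity>"
      using fin[OF that] SM sets_M
      by (intro nn_integral_PInf_AE borel_measurable_times_ennreal borel_measurable_indicator) auto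
    then show ?thesis
    proof eventually_elim
      case (elim y)
      show ?case
      proof
        assume "y \<in> ball x r"
        then have "w y \<noteq> 0" using elim by (auto simp: S)
        then show "0 < w y" using w0[of y] by simp
      qed
    qed
  qed
  have pos: "emeasure (W w) (ball x r) \<noteq> 0" if r: "0 < r" for x r
  proof
    assume z: "emeasure (W w) (ball x r) = 0"
    \<comment> \<open>The ball of this radius around \<open>x\<close> contains both
      \<open>ball x r\<close> and \<open>ball x1 r1\<close>, so positivity almost everywhere reaches
      \<open>ball x r\<close>.\<close>
    define R where "R = dist x x1 + r + \<bar>r1\<bar>"
    have R: "0 < R" using r by (simp add: R_def add_nonneg_pos add_pos_nonneg)
    have "ball x1 r1 \<subseteq> ball x R"
    proof
      fix z assume "z \<in> ball x1 r1"
      then show "z \<in> ball x R" using dist_triangle[of x z x1] r by (simp add: R_def)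
    qed
    then have "emeasure (W w) (ball x1 r1) \<le> emeasure (W w) (ball x R)"
      using sets_M by (intro emeasure_mono) auto
    then have "emeasure (W w) (ball x R) \<noteq> 0" using nz by auto
    then have "AE y in M. y \<in> ball x R \<longrightarrow> 0 < w y" by (rule AE_ball[OF R])
    then have "AE y in M. y \<in> ball x r \<longrightarrow> 0 < w y"
    proof eventually_elim
      case (elim y)
      have "y \<in> ball x R" if "y \<in> ball x r" 
        using that zero_le_dist[of x x1] abs_ge_zero[of r1] unfolding R_def mem_ball by linarith
      then show ?case using elim by blast
    qed
    then have "0 < emeasure (W w) (ball x r)" using r by (intro emeasure_W_ball_pos) auto
    then show False using z by simp
  qed
  show pw: "positive_weight w"
    unfolding positive_weight_def using weight_finite[OF wt] pos
    by (intro conjI allI impI) (simp_all add: zero_less_iff_neq_zero)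
  show AEpos: "AE y in M. 0 < w y"
    by (rule AE_from_balls, rule AE_ball, assumption, rule pos)
  have S_int: "(\<integral>\<^sup>+y\<in>ball x r. ?S y \<partial>M) = emeasure (W ?\<sigma>) (ball x r)" for x r
  proof -
    have "(\<integral>\<^sup>+y\<in>ball x r. ?S y \<partial>M) = (\<integral>\<^sup>+y. ennreal (?\<sigma> y) * indicator (ball x r) y \<partial>M)"
      by (intro nn_integral_cong_AE eventually_mono[OF AEpos]) (auto simp: S)
    then show ?thesis by (simp add: emeasure_W)
  qed
  show p\<sigma>: "positive_weight ?\<sigma>"
    unfolding positive_weight_def
  proof (intro conjI allI impI)
    fix x and r :: real assume r: "0 < r"
    show "emeasure (W ?\<sigma>) (ball x r) < \<infinity>" using fin[OF r pos[OF r]] by (simp add: S_int)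
    show "0 < emeasure (W ?\<sigma>) (ball x r)"
      using AEpos r by (intro emeasure_W_ball_pos) (auto elim!: eventually_mono)
  qed auto
  have "mean w x r * mean ?\<sigma> x r powr (1 / \<alpha>) \<le> max 1 A0" if r: "0 < r" for x r
  proof -
    have 1: "avg M (ball x r) (\<lambda>y. ennreal (w y)) = ennreal (mean w x r)"
      using positive_weightD[OF pw] r by (intro avg_eq_mean) auto
    have "avg M (ball x r) ?S = avg M (ball x r) (\<lambda>y. ennreal (?\<sigma> y))"
      by (simp add: avg_def S_int emeasure_W)
    also have "\<dots> = ennreal (mean ?\<sigma> x r)"
      using positive_weightD[OF p\<sigma>] r by (intro avg_eq_mean) auto
    finally have "ennreal (mean w x r) * ennreal (mean ?\<sigma> x r powr (1 / \<alpha>)) \<le> ennreal A0"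
      using A0[OF r, of x] \<alpha> positive_weightD(6)[OF p\<sigma> r, of x] unfolding 1
      by (simp add: enn_powr_ennreal_nonneg)
    also have "\<dots> \<le> ennreal (max 1 A0)" by (intro ennreal_leI) simp
    finally show ?thesis
      using positive_weightD(6)[OF pw r, of x] by (simp add: ennreal_mult[symmetric])
  qed
  then show "\<exists>A>0. \<forall>x. \<forall>r>0. mean w x r * mean ?\<sigma> x r powr (1 / \<alpha>) \<le> A"
    by (intro exI[of _ "max 1 A0"]) auto
qed

lemma RH_power_weight:
  assumes w: "w \<in> RH M (ennreal s)" and s: "1 \<le> s" and pw: "positive_weight w"
    and AEpos: "AE y in M. 0 < w y"
  shows "positive_weight (\<lambda>y. w y powr s)"
    and "\<exists>R\<ge>1. \<forall>x. \<forall>r>0. mean (\<lambda>y. w y powr s) x r \<le> (R * mean w x r) powr s"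
proof -
  note [measurable] = positive_weightD(1)[OF pw]
  have w0: "0 \<le> w y" for y by (rule positive_weightD(3)[OF pw])
  let ?v = "\<lambda>y. w y powr s"
  have "positive_weight ?v \<and> (\<exists>R\<ge>1. \<forall>x. \<forall>r>0. mean ?v x r \<le> (R * mean w x r) powr s)"
  proof (cases "s = 1")
    \<comment> \<open>For \<open>s = 1\<close> membership in the class carries no bound, but the
      claim is then an equality with constant 1.\<close>
    case True
    then have "?v = w" using w0 by auto
    then show ?thesis
      using True pw positive_weightD(6)[OF pw]
      by (auto intro!: exI[of _ 1] simp: less_imp_le powr_one)
  next
    case False
    then have "ennreal s \<noteq> 1" using s by (simp flip: ennreal_1)
    moreover have "enn2real (ennreal s) = s" using s by simp
    ultimately obtain R where R: "\<And>x r. 0 < r \<Longrightarrow>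
        enn_powr (avg M (ball x r) (\<lambda>y. enn_powr (ennreal (w y)) s)) (1 / s)
          \<le> ennreal R * avg M (ball x r) (\<lambda>y. ennreal (w y))"
      using w unfolding RH_def by auto
    have ev: "enn_powr (ennreal (w y)) s = ennreal (?v y)" for y
      using w0[of y] s by (simp add: enn_powr_ennreal_nonneg)
    have 1: "avg M (ball x r) (\<lambda>y. ennreal (w y)) = ennreal (mean w x r)" if r: "0 < r" for x r
      using positive_weightD[OF pw] r by (intro avg_eq_mean) auto
    have pv: "positive_weight ?v"
      unfolding positive_weight_def
    proof (intro conjI allI impI)
      fix x and r :: real assume r: "0 < r"
      show "emeasure (W ?v) (ball x r) < \<infinity>"
      proof (rule ccontr)
        assume "\<not> ?thesis"
        then have "avg M (ball x r) (\<lambda>y. ennreal (?v y)) = \<infinity>"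
          using emeasure_ball_finite[of x r]
          by (simp add: avg_def emeasure_W ennreal_top_divide less_top[symmetric])
        then show False
          using R[OF r, of x] s unfolding ev 1[OF r] by (simp add: enn_powr_top top_unique ennreal_mult_eq_top_iff)
      qed
      show "0 < emeasure (W ?v) (ball x r)"
        using AEpos r by (intro emeasure_W_ball_pos) (auto elim!: eventually_mono)
    qed auto
    have "mean ?v x r \<le> (max 1 R * mean w x r) powr s" if r: "0 < r" for x r
    proof -
      note m = positive_weightD(6)[OF pw r, of x] positive_weightD(6)[OF pv r, of x]
      have "avg M (ball x r) (\<lambda>y. ennreal (?v y)) = ennreal (mean ?v x r)"
        using positive_weightD[OF pv] r by (intro avg_eq_mean) auto
      then have "ennreal (mean ?v x r powr (1 / s)) \<le> ennreal R * ennreal (mean w x r)"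
        using R[OF r, of x] s m unfolding ev 1[OF r] by (simp add: enn_powr_ennreal_nonneg)
      also have "\<dots> \<le> ennreal (max 1 R) * ennreal (mean w x r)"
        by (intro mult_right_mono ennreal_leI) auto
      also have "\<dots> = ennreal (max 1 R * mean w x r)" using m by (simp add: ennreal_mult)
      finally have "mean ?v x r powr (1 / s) \<le> max 1 R * mean w x r"
        using m by (subst (asm) ennreal_le_iff) auto
      then have "(mean ?v x r powr (1 / s)) powr s \<le> (max 1 R * mean w x r) powr s"
        using s by (intro powr_mono2) auto
      then show ?thesis using s m by (simp add: powr_powr)
    qed
    then show ?thesis using pv by (intro conjI exI[of _ "max 1 R"]) auto
  qed
  then show "positive_weight ?v" "\<exists>R\<ge>1. \<forall>x. \<forall>r>0. mean ?v x r \<le> (R * mean w x r) powr s"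
    by blast+
qed

end

subsection \<open>Comparison of weighted and unweighted averages\<close>

text \<open>The integrals enter through finite bounds \<open>A\<close> and \<open>B\<close>, so the
  result involves real powers only. For positive bounds, Young's inequality is applied to
  \<open>f / a\<close> and \<open>g / b\<close>, normalised so that the two terms contribute
  \<open>a * b / r\<close> and \<open>a * b / r'\<close>. A zero bound makes the product vanish
  almost everywhere.\<close>

lemma nn_integral_Hoelder:
  fixes f g :: "'a \<Rightarrow> real"
  assumes f[measurable]: "f \<in> borel_measurable M" and g[measurable]: "g \<in> borel_measurable M"
    and nn: "\<And>y. 0 \<le> f y" "\<And>y. 0 \<le> g y"
    and r: "1 < r" "1 < r'" "1 / r + 1 / r' = 1" and AB: "0 \<le> A" "0 \<le> B"
    and fA: "(\<integral>\<^sup>+y. ennreal (f y powr r) \<partial>M) \<le> ennreal A"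
    and gB: "(\<integral>\<^sup>+y. ennreal (g y powr r') \<partial>M) \<le> ennreal B"
  shows "(\<integral>\<^sup>+y. ennreal (f y * g y) \<partial>M) \<le> ennreal (A powr (1 / r) * B powr (1 / r'))"
proof (cases "A = 0 \<or> B = 0")
  case True
  have "AE y in M. f y * g y = 0"
  proof (cases "A = 0")
    case True
    then have "AE y in M. ennreal (f y powr r) = 0"
      using fA by (subst nn_integral_0_iff_AE[symmetric]) auto
    then show ?thesis by eventually_elim (use nn in \<open>auto simp: ennreal_eq_0_iff\<close>)
  next
    case False
    then have "AE y in M. ennreal (g y powr r') = 0"
      using gB \<open>A = 0 \<or> B = 0\<close> by (subst nn_integral_0_iff_AE[symmetric]) auto
    then show ?thesis by eventually_elim (use nn in \<open>auto simp: ennreal_eq_0_iff\<close>)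
  qed
  then have "(\<integral>\<^sup>+y. ennreal (f y * g y) \<partial>M) = 0"
    by (subst nn_integral_0_iff_AE) (auto elim!: eventually_mono)
  then show ?thesis by simp
next
  case False
  then have pos: "0 < A" "0 < B" using AB by auto
  define a where "a = A powr (1 / r)"
  define b where "b = B powr (1 / r')"
  have ab: "0 < a" "0 < b" "a powr r = A" "b powr r' = B"
    using pos r by (auto simp: a_def b_def powr_powr)
  have Young: "f y * g y \<le> a * b / (A * r) * f y powr r + a * b / (B * r') * g y powr r'" for y
  proof -
    have "(f y / a) * (g y / b) \<le> (f y / a) powr r / r + (g y / b) powr r' / r'"
      using r ab nn by (intro Youngs_inequality) auto
    also have "\<dots> = f y powr r / (A * r) + g y powr r' / (B * r')"
      using ab nn by (simp add: powr_divide)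
    finally have "a * b * ((f y / a) * (g y / b)) \<le> a * b * (f y powr r / (A * r) + g y powr r' / (B * r'))"
      using ab by (intro mult_left_mono) auto
    then show ?thesis using ab by (simp add: distrib_left)
  qed
  have c: "0 \<le> a * b / (A * r)" "0 \<le> a * b / (B * r')" using ab pos r by auto
  have "(\<integral>\<^sup>+y. ennreal (f y * g y) \<partial>M)
      \<le> (\<integral>\<^sup>+y. ennreal (a * b / (A * r)) * ennreal (f y powr r) + ennreal (a * b / (B * r')) * ennreal (g y powr r') \<partial>M)"
  proof (rule nn_integral_mono)
    fix y
    have "ennreal (f y * g y) \<le> ennreal (a * b / (A * r) * f y powr r + a * b / (B * r') * g y powr r')"
      using Young by (rule ennreal_leI)
    also have "\<dots> = ennreal (a * b / (A * r) * f y powr r) + ennreal (a * b / (B * r') * g y powr r')"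
      using c by (intro ennreal_plus mult_nonneg_nonneg) auto
    also have "\<dots> = ennreal (a * b / (A * r)) * ennreal (f y powr r) + ennreal (a * b / (B * r')) * ennreal (g y powr r')"
      using c by (intro arg_cong2[where f = "(+)"] ennreal_mult) auto
    finally show "ennreal (f y * g y)
      \<le> ennreal (a * b / (A * r)) * ennreal (f y powr r) + ennreal (a * b / (B * r')) * ennreal (g y powr r')" .
  qed
  also have "\<dots> = ennreal (a * b / (A * r)) * (\<integral>\<^sup>+y. ennreal (f y powr r) \<partial>M)
      + ennreal (a * b / (B * r')) * (\<integral>\<^sup>+y. ennreal (g y powr r') \<partial>M)"
    by (subst nn_integral_add) (auto simp: nn_integral_cmult)
  also have "\<dots> \<le> ennreal (a * b / (A * r)) * ennreal A + ennreal (a * b / (B * r')) * ennreal B"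
    using fA gB by (intro add_mono mult_left_mono) auto
  also have "\<dots> = ennreal (a * b / (A * r) * A + a * b / (B * r') * B)"
    using c AB by (simp only: ennreal_mult ennreal_plus mult_nonneg_nonneg)
  also have "a * b / (A * r) * A + a * b / (B * r') * B = a * b * (1 / r + 1 / r')"
    using pos by (simp add: field_simps)
  finally show ?thesis by (simp add: r a_def b_def)
qed

lemma Lp_avg_ennreal:
  assumes "0 < p"
  shows "Lp_avg N (ennreal p) B E g
    = enn_powr ((\<integral>\<^sup>+y\<in>E. ennreal (norm (g y) powr p) \<partial>N) / emeasure N B) (1 / p)"
  using assms by (simp add: Lp_avg_def)

context doubling_measure
begin

lemma set_nn_integral_W:
  assumes "v \<in> borel_measurable borel" "E \<in> sets borel" "f \<in> borel_measurable M"
    and "\<And>y. 0 \<le> v y"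
  shows "(\<integral>\<^sup>+y\<in>E. ennreal (f y) \<partial>W v) = (\<integral>\<^sup>+y. ennreal (v y * f y) * indicator E y \<partial>M)"
proof -
  have "(\<lambda>y. ennreal (f y) * indicator E y) \<in> borel_measurable M"
    using assms sets_M by (intro borel_measurable_times_ennreal borel_measurable_indicator) auto
  then show ?thesis
    using assms borel_measurable_M[OF assms(1)]
    by (subst nn_integral_density) (auto simp: ennreal_mult' mult.assoc)
qed

text \<open>Hoelder with exponent \<open>s / (s - 1)\<close> for the power of \<open>g\<close> and
  \<open>s\<close> for \<open>w\<close>. The bound \<open>RH\<close> returns exactly one factor
  \<open>mean w x r\<close>, which together with the measure of the ball cancels the weighted
  normalisation. Integrating over a subset \<open>E\<close> of the ball covers balls and annuli
  alike.\<close>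

lemma Lp_avg_W_le_Lp_avg:
  fixes g :: "'a \<Rightarrow> 'b::real_normed_vector"
  assumes pw: "positive_weight w" and s: "1 < s" and q: "0 < q" and A: "0 < A"
    and RH: "\<And>x r. 0 < r \<Longrightarrow> (\<integral>\<^sup>+y\<in>ball x r. ennreal (w y powr s) \<partial>M)
      \<le> ennreal (A * mean w x r powr s * measure M (ball x r))"
    and r: "0 < r" and E: "E \<in> sets borel" "E \<subseteq> ball x r" and g: "g \<in> borel_measurable M"
  shows "Lp_avg (W w) (ennreal q) (ball x r) E g
    \<le> ennreal (A powr (1 / (s * q))) * Lp_avg M (ennreal (q * (s / (s - 1)))) (ball x r) E g"
proof -
  note [measurable] = positive_weightD(2)[OF pw] g
  have EM[measurable]: "E \<in> sets M" and bM[measurable]: "ball x r \<in> sets M" using E sets_M by auto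
  have w0: "0 \<le> w y" for y by (rule positive_weightD(3)[OF pw])
  define s' where "s' = s / (s - 1)"
  have s': "1 < s'" "1 / s' + 1 / s = 1" using s by (auto simp: s'_def field_simps)
  let ?m = "mean w x r" and ?\<mu> = "measure M (ball x r)"
  have m: "0 < ?m" and \<mu>: "0 < ?\<mu>" using r positive_weightD(6)[OF pw] measure_ball_pos by auto
  let ?I = "\<integral>\<^sup>+y\<in>E. ennreal (norm (g y) powr (q * s')) \<partial>M"
  have q': "0 < q * s'" using q s' by simp
  have K: "0 < A powr (1 / (s * q))" using A by simp
  have R: "Lp_avg M (ennreal (q * s')) (ball x r) E g = enn_powr (?I / ennreal ?\<mu>) (1 / (q * s'))"
    using q' by (simp only: Lp_avg_ennreal emeasure_ball_eq)
  show ?thesis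
  proof (cases "?I = \<infinity>")
    case True
    then have "Lp_avg M (ennreal (q * s')) (ball x r) E g = top"
      unfolding R using q' by (simp add: ennreal_top_divide enn_powr_top)
    then show ?thesis using K by (simp add: s'_def[symmetric] ennreal_mult_top)
  next
    case False
    then obtain a where a: "0 \<le> a" "?I = ennreal a" by (cases ?I) auto
    define z where "z = a / ?\<mu>"
    have z: "0 \<le> z" "a = z * ?\<mu>" using a \<mu> by (auto simp: z_def)
    have R': "Lp_avg M (ennreal (q * s')) (ball x r) E g = ennreal (z powr (1 / (q * s')))"
      unfolding R a(2) using \<mu> q' a(1) by (simp add: divide_ennreal z_def enn_powr_ennreal_nonneg)
    let ?B = "A * ?m powr s * ?\<mu>"
    have "(\<integral>\<^sup>+y\<in>E. ennreal (norm (g y) powr q) \<partial>W w)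
        = (\<integral>\<^sup>+y. ennreal (w y * norm (g y) powr q) * indicator E y \<partial>M)"
      using w0 positive_weightD(1)[OF pw] E by (intro set_nn_integral_W) auto
    also have "\<dots> = (\<integral>\<^sup>+y. ennreal ((norm (g y) powr q * indicator E y) * (w y * indicator (ball x r) y)) \<partial>M)"
      using E by (intro nn_integral_cong) (auto split: split_indicator simp: mult.commute)
    also have "\<dots> \<le> ennreal (a powr (1 / s') * ?B powr (1 / s))"
    proof (rule nn_integral_Hoelder)
      have "(\<integral>\<^sup>+y. ennreal ((norm (g y) powr q * indicator E y) powr s') \<partial>M) = ?I"
        using s' by (intro nn_integral_cong) (auto split: split_indicator simp: powr_powr)
      then show "(\<integral>\<^sup>+y. ennreal ((norm (g y) powr q * indicator E y) powr s') \<partial>M) \<le> ennreal a"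
        using a by simp
      have "(\<integral>\<^sup>+y. ennreal ((w y * indicator (ball x r) y) powr s) \<partial>M) = (\<integral>\<^sup>+y\<in>ball x r. ennreal (w y powr s) \<partial>M)"
        using s by (intro nn_integral_cong) (auto split: split_indicator)
      then show "(\<integral>\<^sup>+y. ennreal ((w y * indicator (ball x r) y) powr s) \<partial>M) \<le> ennreal ?B"
        using RH[OF r, of x] by simp
      show "(\<lambda>y. norm (g y) powr q * indicator E y) \<in> borel_measurable M"
        "(\<lambda>y. w y * indicator (ball x r) y) \<in> borel_measurable M" by measurable
      show "0 \<le> norm (g y) powr q * indicator E y" "0 \<le> w y * indicator (ball x r) y" for y
        using w0[of y] by auto
      show "0 \<le> ?B" using A \<mu> by simp
    qed (fact s s' a)+
    also have "a powr (1 / s') * ?B powr (1 / s) = z powr (1 / s') * A powr (1 / s) * ?m * (?\<mu> powr (1 / s') * ?\<mu> powr (1 / s))"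
      using z A m \<mu> s by (simp add: powr_mult powr_powr mult_ac)
    also have "?\<mu> powr (1 / s') * ?\<mu> powr (1 / s) = ?\<mu>"
      using s' \<mu> by (simp flip: powr_add)
    finally have le: "(\<integral>\<^sup>+y\<in>E. ennreal (norm (g y) powr q) \<partial>W w)
        \<le> ennreal (z powr (1 / s') * A powr (1 / s) * (?m * ?\<mu>))" by (simp add: mult.assoc)
    have "Lp_avg (W w) (ennreal q) (ball x r) E g
        = enn_powr ((\<integral>\<^sup>+y\<in>E. ennreal (norm (g y) powr q) \<partial>W w) / ennreal (?m * ?\<mu>)) (1 / q)"
      using q r by (simp only: Lp_avg_ennreal positive_weightD(7)[OF pw] mean_eq)
    also have "\<dots> \<le> enn_powr (ennreal (z powr (1 / s') * A powr (1 / s) * (?m * ?\<mu>)) / ennreal (?m * ?\<mu>)) (1 / q)"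
      using le q by (intro enn_powr_mono divide_right_mono_ennreal) auto
    also have "\<dots> = enn_powr (ennreal (z powr (1 / s') * A powr (1 / s))) (1 / q)"
      using m \<mu> by (subst divide_ennreal) auto
    also have "\<dots> = ennreal ((z powr (1 / s') * A powr (1 / s)) powr (1 / q))"
      using q by (intro enn_powr_ennreal_nonneg) auto
    also have "(z powr (1 / s') * A powr (1 / s)) powr (1 / q) = A powr (1 / (s * q)) * z powr (1 / (q * s'))"
      by (simp add: powr_mult powr_powr mult.commute)
    also have "ennreal \<dots> = ennreal (A powr (1 / (s * q))) * ennreal (z powr (1 / (q * s')))"
      by (simp add: ennreal_mult)
    finally show ?thesis by (simp only: R' s'_def[symmetric])
  qed
qed

text \<open>For \<open>\<alpha> = 1 / (p / p0 - 1)\<close> the exponent on the left is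
  \<open>p0\<close>, and it increases with \<alpha>; any better integrability of negative powers of
  \<open>w\<close> thus leads above \<open>p0\<close>.\<close>

lemma Lp_avg_le_Lp_avg_W:
  fixes f :: "'a \<Rightarrow> 'b::real_normed_vector"
  assumes pw: "positive_weight w" and AEpos: "AE y in M. 0 < w y" and \<alpha>: "0 < \<alpha>" and p: "0 < p" and A: "0 < A"
    and dual: "\<And>x r. 0 < r \<Longrightarrow> (\<integral>\<^sup>+y\<in>ball x r. ennreal (w y powr (- \<alpha>)) \<partial>M)
      \<le> ennreal (A * mean w x r powr (- \<alpha>) * measure M (ball x r))"
    and r: "0 < r" and E: "E \<in> sets borel" "E \<subseteq> ball x r" and f: "f \<in> borel_measurable M"
  shows "Lp_avg M (ennreal (p * (\<alpha> / (1 + \<alpha>)))) (ball x r) E f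
    \<le> ennreal (A powr (1 / (p * \<alpha>))) * Lp_avg (W w) (ennreal p) (ball x r) E f"
proof -
  note [measurable] = positive_weightD(2)[OF pw] f
  have EM[measurable]: "E \<in> sets M" and bM[measurable]: "ball x r \<in> sets M" using E sets_M by auto
  have w0: "0 \<le> w y" for y by (rule positive_weightD(3)[OF pw])
  \<comment> \<open>This is \<open>p / p1\<close>, with conjugate exponent
    \<open>1 + \<alpha>\<close>. Inserting \<open>w powr (1 / \<rho>)\<close> and its inverse turns
    one Hoelder factor into the weighted integral and the other into that of
    \<open>w powr (- \<alpha>)\<close>, because
    \<open>(1 + \<alpha>) / \<rho> = \<alpha>\<close>.\<close>
  define \<rho> where "\<rho> = (1 + \<alpha>) / \<alpha>"
  have \<rho>: "1 < \<rho>" "1 / \<rho> + 1 / (1 + \<alpha>) = 1" "1 / \<rho> = \<alpha> / (1 + \<alpha>)"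
    using \<alpha> by (auto simp: \<rho>_def field_simps)
  define p1 where "p1 = p * (\<alpha> / (1 + \<alpha>))"
  have p1: "0 < p1" "p1 * \<rho> = p" using p \<alpha> by (auto simp: p1_def \<rho>_def)
  let ?m = "mean w x r" and ?\<mu> = "measure M (ball x r)"
  have m: "0 < ?m" and \<mu>: "0 < ?\<mu>" using r positive_weightD(6)[OF pw] measure_ball_pos by auto
  let ?I = "\<integral>\<^sup>+y\<in>E. ennreal (norm (f y) powr p) \<partial>W w"
  have K: "0 < A powr (1 / (p * \<alpha>))" using A by simp
  have R: "Lp_avg (W w) (ennreal p) (ball x r) E f = enn_powr (?I / ennreal (?m * ?\<mu>)) (1 / p)"
    using p r by (simp only: Lp_avg_ennreal positive_weightD(7)[OF pw] mean_eq)
  show ?thesis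
  proof (cases "?I = \<infinity>")
    case True
    then have "Lp_avg (W w) (ennreal p) (ball x r) E f = top"
      unfolding R using p by (simp add: ennreal_top_divide enn_powr_top)
    then show ?thesis using K by (simp add: ennreal_mult_top)
  next
    case False
    then obtain a where a: "0 \<le> a" "?I = ennreal a" by (cases ?I) auto
    define z where "z = a / (?m * ?\<mu>)"
    have z: "0 \<le> z" "a = z * (?m * ?\<mu>)" using a \<mu> m by (auto simp: z_def)
    have R': "Lp_avg (W w) (ennreal p) (ball x r) E f = ennreal (z powr (1 / p))"
      unfolding R a(2) using \<mu> m p a(1) by (simp add: divide_ennreal z_def enn_powr_ennreal_nonneg)
    let ?B = "A * ?m powr (- \<alpha>) * ?\<mu>"
    have "(\<integral>\<^sup>+y\<in>E. ennreal (norm (f y) powr p1) \<partial>M)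
        = (\<integral>\<^sup>+y. ennreal ((norm (f y) powr p1 * w y powr (1 / \<rho>) * indicator E y)
            * (w y powr (- (1 / \<rho>)) * indicator (ball x r) y)) \<partial>M)"
    proof (intro nn_integral_cong_AE eventually_mono[OF AEpos])
      fix y assume "0 < w y"
      then have "w y powr (1 / \<rho>) * w y powr (- (1 / \<rho>)) = 1" by (simp flip: powr_add)
      then show "ennreal (norm (f y) powr p1) * indicator E y
          = ennreal ((norm (f y) powr p1 * w y powr (1 / \<rho>) * indicator E y)
            * (w y powr (- (1 / \<rho>)) * indicator (ball x r) y))"
        using E by (auto split: split_indicator simp: mult.assoc)
    qed
    also have "\<dots> \<le> ennreal (a powr (1 / \<rho>) * ?B powr (1 / (1 + \<alpha>)))"
    proof (rule nn_integral_Hoelder)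
      have "(\<integral>\<^sup>+y. ennreal ((norm (f y) powr p1 * w y powr (1 / \<rho>) * indicator E y) powr \<rho>) \<partial>M)
          = (\<integral>\<^sup>+y. ennreal (w y * norm (f y) powr p) * indicator E y \<partial>M)"
        using \<rho>(1) p1 w0
        by (intro nn_integral_cong) (auto split: split_indicator simp: powr_mult powr_powr mult.commute)
      also have "\<dots> = ?I"
        using w0 positive_weightD(1)[OF pw] E by (intro set_nn_integral_W[symmetric]) auto
      finally show "(\<integral>\<^sup>+y. ennreal ((norm (f y) powr p1 * w y powr (1 / \<rho>) * indicator E y) powr \<rho>) \<partial>M) \<le> ennreal a"
        using a by simp
      have "- (1 / \<rho>) * (1 + \<alpha>) = - \<alpha>" using \<rho>(3) \<alpha> by simp
      then have "(\<integral>\<^sup>+y. ennreal ((w y powr (- (1 / \<rho>)) * indicator (ball x r) y) powr (1 + \<alpha>)) \<partial>M)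
          = (\<integral>\<^sup>+y\<in>ball x r. ennreal (w y powr (- \<alpha>)) \<partial>M)"
        using \<alpha> by (intro nn_integral_cong) (auto split: split_indicator simp: powr_powr simp del: minus_mult_left[symmetric])
      then show "(\<integral>\<^sup>+y. ennreal ((w y powr (- (1 / \<rho>)) * indicator (ball x r) y) powr (1 + \<alpha>)) \<partial>M) \<le> ennreal ?B"
        using dual[OF r, of x] by simp
      show "(\<lambda>y. norm (f y) powr p1 * w y powr (1 / \<rho>) * indicator E y) \<in> borel_measurable M"
        "(\<lambda>y. w y powr (- (1 / \<rho>)) * indicator (ball x r) y) \<in> borel_measurable M" by measurable
      show "0 \<le> norm (f y) powr p1 * w y powr (1 / \<rho>) * indicator E y"
        "0 \<le> w y powr (- (1 / \<rho>)) * indicator (ball x r) y" for y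
        by auto
      show "0 \<le> ?B" using A \<mu> by simp
      show "1 < 1 + \<alpha>" using \<alpha> by simp
    qed (fact \<rho> a)+
    also have "a powr (1 / \<rho>) * ?B powr (1 / (1 + \<alpha>))
        = z powr (1 / \<rho>) * A powr (1 / (1 + \<alpha>)) * (?m powr (1 / \<rho>) * ?m powr (- \<alpha> / (1 + \<alpha>)))
          * (?\<mu> powr (1 / \<rho>) * ?\<mu> powr (1 / (1 + \<alpha>)))"
      using z A m \<mu> by (simp add: powr_mult powr_powr mult_ac)
    also have "?m powr (1 / \<rho>) * ?m powr (- \<alpha> / (1 + \<alpha>)) = 1"
      unfolding \<rho>(3) using m by (simp flip: powr_add)
    also have "?\<mu> powr (1 / \<rho>) * ?\<mu> powr (1 / (1 + \<alpha>)) = ?\<mu>"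
      using \<rho> \<mu> by (simp flip: powr_add)
    finally have le: "(\<integral>\<^sup>+y\<in>E. ennreal (norm (f y) powr p1) \<partial>M)
        \<le> ennreal (z powr (1 / \<rho>) * A powr (1 / (1 + \<alpha>)) * ?\<mu>)" by simp
    have "Lp_avg M (ennreal p1) (ball x r) E f
        = enn_powr ((\<integral>\<^sup>+y\<in>E. ennreal (norm (f y) powr p1) \<partial>M) / ennreal ?\<mu>) (1 / p1)"
      using p1(1) by (simp only: Lp_avg_ennreal emeasure_ball_eq)
    also have "\<dots> \<le> enn_powr (ennreal (z powr (1 / \<rho>) * A powr (1 / (1 + \<alpha>)) * ?\<mu>) / ennreal ?\<mu>) (1 / p1)"
      using le p1 by (intro enn_powr_mono divide_right_mono_ennreal) auto
    also have "\<dots> = enn_powr (ennreal (z powr (1 / \<rho>) * A powr (1 / (1 + \<alpha>)))) (1 / p1)"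
      using \<mu> by (subst divide_ennreal) auto
    also have "\<dots> = ennreal ((z powr (1 / \<rho>) * A powr (1 / (1 + \<alpha>))) powr (1 / p1))"
      using p1 by (intro enn_powr_ennreal_nonneg) auto
    also have "(z powr (1 / \<rho>) * A powr (1 / (1 + \<alpha>))) powr (1 / p1)
        = z powr (1 / (p1 * \<rho>)) * A powr (1 / ((1 + \<alpha>) * p1))"
      by (simp add: powr_mult powr_powr mult.commute)
    also have "\<dots> = A powr (1 / (p * \<alpha>)) * z powr (1 / p)"
      using \<alpha> p1(2) by (simp add: p1_def)
    also have "ennreal \<dots> = ennreal (A powr (1 / (p * \<alpha>))) * ennreal (z powr (1 / p))"
      by (simp add: ennreal_mult)
    finally show ?thesis by (simp only: R' p1_def[symmetric])
  qed
qed

section \<open>Self-improvement of the Muckenhoupt and reverse Hoelder conditions\<close>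

lemma Ap_open_ended:
  assumes w: "w \<in> Ap M (ennreal P)" and P: "1 < P" and nz: "emeasure (W w) (ball x1 r1) \<noteq> 0"
  shows "\<exists>\<alpha>>1 / (P - 1). \<exists>A>0. \<forall>x. \<forall>r>0. (\<integral>\<^sup>+y\<in>ball x r. ennreal (w y powr (- \<alpha>)) \<partial>M)
      \<le> ennreal (A * mean w x r powr (- \<alpha>) * measure M (ball x r))"
    and "\<exists>\<beta>>0. \<beta> < 1 \<and> A_infinity \<beta> w"
proof -
  define \<alpha> where "\<alpha> = 1 / (P - 1)"
  have \<alpha>: "0 < \<alpha>" using P by (simp add: \<alpha>_def)
  let ?\<sigma> = "\<lambda>y. w y powr (- \<alpha>)"
  note dual = Ap_dual_weight[OF w P nz, folded \<alpha>_def]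
  note pw = dual(1) and p\<sigma> = dual(2) and AEpos = dual(3)
  obtain A where A: "0 < A" "\<And>x r. 0 < r \<Longrightarrow> mean w x r * mean ?\<sigma> x r powr (1 / \<alpha>) \<le> A"
    using dual(4) by blast
  show "\<exists>\<beta>>0. \<beta> < 1 \<and> A_infinity \<beta> w"
    using AEpos A \<alpha> by (intro A_infinity_of_dual[OF pw p\<sigma> \<alpha>]) auto
  have \<sigma>_le: "mean ?\<sigma> x r \<le> A powr \<alpha> * mean w x r powr (- \<alpha>)" if r: "0 < r" for x r
  proof -
    note m = positive_weightD(6)[OF pw r, of x] positive_weightD(6)[OF p\<sigma> r, of x]
    have "mean ?\<sigma> x r powr (1 / \<alpha>) \<le> A / mean w x r"
      using A(2)[OF r, of x] m by (simp add: field_simps)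
    then have "(mean ?\<sigma> x r powr (1 / \<alpha>)) powr \<alpha> \<le> (A / mean w x r) powr \<alpha>"
      using \<alpha> by (intro powr_mono2) auto
    then show ?thesis using \<alpha> m by (simp add: powr_powr powr_divide powr_minus_divide)
  qed
  \<comment> \<open>The A_p condition is symmetric: \<open>w\<close> is the power of
    \<open>?\<sigma>\<close> with exponent \<open>- (1 / \<alpha>)\<close>, so the criterion applied
    to \<open>w\<close> applies to \<open>?\<sigma>\<close> as well. The reverse Hoelder inequality
    for \<open>?\<sigma>\<close> then raises \<alpha> to
    \<open>\<alpha> * (1 + \<delta>)\<close>.\<close>
  have "\<exists>\<beta>>0. \<beta> < 1 \<and> A_infinity \<beta> ?\<sigma>"
  proof (rule A_infinity_of_dual[OF p\<sigma> pw, of "1 / \<alpha>" "A powr \<alpha>"])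
    show "AE y in M. 0 < ?\<sigma> y \<and> w y = ?\<sigma> y powr (- (1 / \<alpha>))"
      using AEpos by eventually_elim (use \<alpha> in \<open>simp add: powr_powr\<close>)
    fix x and r :: real assume r: "0 < r"
    have "mean ?\<sigma> x r * mean w x r powr \<alpha> \<le> A powr \<alpha> * mean w x r powr (- \<alpha>) * mean w x r powr \<alpha>"
      using \<sigma>_le[OF r] by (intro mult_right_mono) auto
    also have "\<dots> = A powr \<alpha>"
      using positive_weightD(6)[OF pw r, of x] by (simp add: mult.assoc flip: powr_add)
    finally show "mean ?\<sigma> x r * mean w x r powr (1 / (1 / \<alpha>)) \<le> A powr \<alpha>" by simp
  qed (use \<alpha> A in auto)
  then obtain \<beta> where \<beta>: "0 < \<beta>" "\<beta> < 1" "A_infinity \<beta> ?\<sigma>" by blast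
  obtain \<delta> K where \<delta>: "0 < \<delta>" and K: "0 < K"
    and rh: "\<forall>v. A_infinity \<beta> v \<longrightarrow> (\<forall>x. \<forall>r>0. (\<integral>\<^sup>+y\<in>ball x r. ennreal (v y powr (1 + \<delta>)) \<partial>M)
      \<le> ennreal (K * mean v x r powr (1 + \<delta>) * measure M (ball x r)))"
    using reverse_hoelder[OF \<beta>(1,2)] by (elim exE conjE) (rule that)
  let ?\<alpha>1 = "\<alpha> * (1 + \<delta>)" and ?A1 = "K * A powr (\<alpha> * (1 + \<delta>))"
  have "(\<integral>\<^sup>+y\<in>ball x r. ennreal (w y powr (- ?\<alpha>1)) \<partial>M)
      \<le> ennreal (?A1 * mean w x r powr (- ?\<alpha>1) * measure M (ball x r))" if r: "0 < r" for x r
  proof -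
    have "(\<integral>\<^sup>+y\<in>ball x r. ennreal (w y powr (- ?\<alpha>1)) \<partial>M) = (\<integral>\<^sup>+y\<in>ball x r. ennreal (?\<sigma> y powr (1 + \<delta>)) \<partial>M)"
      by (simp add: powr_powr)
    also have "\<dots> \<le> ennreal (K * mean ?\<sigma> x r powr (1 + \<delta>) * measure M (ball x r))"
      using rh \<beta>(3) r by blast
    also have "\<dots> \<le> ennreal (K * (A powr \<alpha> * mean w x r powr (- \<alpha>)) powr (1 + \<delta>) * measure M (ball x r))"
      using \<sigma>_le[OF r, of x] K \<delta> positive_weightD(6)[OF p\<sigma> r, of x]
      by (intro ennreal_leI mult_right_mono mult_left_mono powr_mono2) auto
    also have "(A powr \<alpha> * mean w x r powr (- \<alpha>)) powr (1 + \<delta>) = A powr ?\<alpha>1 * mean w x r powr (- ?\<alpha>1)"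
      by (simp add: powr_mult powr_powr)
    finally show ?thesis by (simp only: mult.assoc)
  qed
  moreover have "\<alpha> < ?\<alpha>1" "0 < ?A1" using \<alpha> \<delta> K A by auto
  ultimately show "\<exists>\<alpha>>1 / (P - 1). \<exists>A>0. \<forall>x. \<forall>r>0. (\<integral>\<^sup>+y\<in>ball x r. ennreal (w y powr (- \<alpha>)) \<partial>M)
      \<le> ennreal (A * mean w x r powr (- \<alpha>) * measure M (ball x r))"
    unfolding \<alpha>_def[symmetric] by blast
qed

text \<open>The improvement is applied to \<open>w powr s\<close>, which inherits the
  \<open>A_infinity\<close> condition from \<open>w\<close>. For \<open>s = 1\<close>, the case that
  arises when \<open>q0\<close> is infinite, it produces a bound where the hypothesis on
  \<open>RH\<close> gives none.\<close>

lemma RH_open_ended: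
  assumes w: "w \<in> RH M (ennreal s)" and s: "1 \<le> s" and u: "A_infinity \<beta> w" and \<beta>: "0 < \<beta>" "\<beta> < 1"
    and AEpos: "AE y in M. 0 < w y"
  shows "\<exists>s1>s. \<exists>A>0. \<forall>x. \<forall>r>0. (\<integral>\<^sup>+y\<in>ball x r. ennreal (w y powr s1) \<partial>M)
      \<le> ennreal (A * mean w x r powr s1 * measure M (ball x r))"
proof -
  let ?v = "\<lambda>y. w y powr s"
  have pw: "positive_weight w" using u by (simp add: A_infinity_def)
  have pv: "positive_weight ?v" using RH_power_weight(1)[OF w s pw AEpos] .
  obtain R where R: "1 \<le> R" "\<And>x r. 0 < r \<Longrightarrow> mean ?v x r \<le> (R * mean w x r) powr s"
    using RH_power_weight(2)[OF w s pw AEpos] by blast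
  define \<gamma> where "\<gamma> = (\<beta> / R) powr s"
  have v: "A_infinity \<gamma> ?v" unfolding \<gamma>_def by (rule A_infinity_powr[OF u pv s \<beta>(1) R])
  have "\<beta> / R < 1" "0 < \<beta> / R" using \<beta> R by auto
  then have \<gamma>: "0 < \<gamma>" "\<gamma> < 1"
    using s powr_less_mono2[of s "\<beta> / R" 1] by (auto simp: \<gamma>_def)
  obtain \<delta> K where \<delta>: "0 < \<delta>" and K: "0 < K"
    and rh: "\<forall>v. A_infinity \<gamma> v \<longrightarrow> (\<forall>x. \<forall>r>0. (\<integral>\<^sup>+y\<in>ball x r. ennreal (v y powr (1 + \<delta>)) \<partial>M)
      \<le> ennreal (K * mean v x r powr (1 + \<delta>) * measure M (ball x r)))"
    using reverse_hoelder[OF \<gamma>] by (elim exE conjE) (rule that)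
  let ?s1 = "s * (1 + \<delta>)" and ?A1 = "K * R powr (s * (1 + \<delta>))"
  have "(\<integral>\<^sup>+y\<in>ball x r. ennreal (w y powr ?s1) \<partial>M)
      \<le> ennreal (?A1 * mean w x r powr ?s1 * measure M (ball x r))" if r: "0 < r" for x r
  proof -
    have "(\<integral>\<^sup>+y\<in>ball x r. ennreal (w y powr ?s1) \<partial>M) = (\<integral>\<^sup>+y\<in>ball x r. ennreal (?v y powr (1 + \<delta>)) \<partial>M)"
      by (simp add: powr_powr)
    also have "\<dots> \<le> ennreal (K * mean ?v x r powr (1 + \<delta>) * measure M (ball x r))"
      using rh v r by blast
    also have "\<dots> \<le> ennreal (K * ((R * mean w x r) powr s) powr (1 + \<delta>) * measure M (ball x r))"
      using R(2)[OF r, of x] K \<delta> positive_weightD(6)[OF pv r, of x]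
      by (intro ennreal_leI mult_right_mono mult_left_mono powr_mono2) auto
    also have "((R * mean w x r) powr s) powr (1 + \<delta>) = R powr ?s1 * mean w x r powr ?s1"
      by (simp add: powr_mult powr_powr)
    finally show ?thesis by (simp only: mult.assoc)
  qed
  moreover have "s < ?s1" "0 < ?A1" using s \<delta> K R by auto
  ultimately show ?thesis by blast
qed

end

section \<open>The degenerate weight and the transfer of the estimates\<close>

lemma Lp_avg_null:
  assumes "emeasure N (ball x r) = 0" "ball x r \<in> sets N" "E \<subseteq> ball x r" "0 < p"
  shows "Lp_avg N (ennreal p) (ball x r) E g = 0"
proof -
  have "AE y in N. y \<notin> ball x r" using assms by (intro AE_not_in) auto
  then have "(\<integral>\<^sup>+y\<in>E. ennreal (norm (g y) powr p) \<partial>N) = (\<integral>\<^sup>+y. 0 \<partial>N)"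
    using assms(3) by (intro nn_integral_cong_AE) (auto elim!: eventually_mono split: split_indicator)
  \<comment> \<open>The quotient is 0 / 0, which is 0 in \<open>ennreal\<close>, and so is its
    positive power.\<close>
  then show ?thesis using assms by (simp add: Lp_avg_ennreal enn_powr_def)
qed

lemma ennreal_mult_chain:
  assumes "L \<le> ennreal K1 * L'" "L' \<le> ennreal X * R'" "R' \<le> ennreal K2 * R"
    and "0 \<le> K1" "0 \<le> X" "0 \<le> K2"
  shows "L \<le> ennreal (K1 * K2 * X) * R"
proof -
  have "L \<le> ennreal K1 * (ennreal X * (ennreal K2 * R))"
    using assms by (meson mult_left_mono order_trans zero_le)
  also have "\<dots> = ennreal (K1 * K2 * X) * R" using assms by (simp add: ennreal_mult mult_ac)
  finally show ?thesis .
qed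

theorem proposition2p4:
  fixes M :: "'a::metric_space measure"
    and p0 q0 p q :: ennreal
    and D :: "('a \<Rightarrow> 'b::real_normed_field) set"
    and T :: "real \<Rightarrow> ('a \<Rightarrow> 'b) \<Rightarrow> 'a \<Rightarrow> 'b"
    and w :: "'a \<Rightarrow> real"
  assumes "homogeneous_type M"
    and "1 \<le> p0" and "p0 < q0"
    and "truncation_space M D"
    and "\<forall>t>0. sublinear_op M D (T t)"
    and "\<forall>p q. p0 < p \<and> p \<le> q \<and> q < q0 \<longrightarrow> off_diagonal_on_balls M D T p q"
    and "p0 < p" and "p \<le> q" and "q < q0"
    and "w \<in> Ap M (p / p0) \<inter> RH M (conj_exp (q0 / q))"
  shows "off_diagonal_on_balls (density M w) D T p q"
proof -
  obtain C0 where "doubling_measure M C0" using assms(1) by (rule homogeneous_type_doubling_measure)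
  then interpret doubling_measure M C0 .
  obtain a where a: "p0 = ennreal a" "1 \<le> a"
    using assms(2,7) by (cases p0) (auto simp flip: ennreal_1)
  have "q \<noteq> top" "p \<noteq> top" using assms(8,9) by (auto simp: top_unique)
  then obtain b c where b: "p = ennreal b" "0 \<le> b" and c: "q = ennreal c" "0 \<le> c"
    by (metis ennreal_cases)
  have abc: "a < b" "b \<le> c" "0 < b" "0 < c"
    using assms(7,8) a b c by (auto simp: ennreal_less_iff)
  define P where "P = b / a"
  have P: "1 < P" "p / p0 = ennreal P" using a b abc by (auto simp: P_def divide_ennreal)
  \<comment> \<open>\<open>s_gap\<close> turns any improvement of \<open>s\<close> into a
    \<open>q1\<close> below \<open>q0\<close>: conjugate exponents decrease strictly, and that of
    \<open>s\<close> is \<open>q0 / q\<close>. For infinite \<open>q0\<close> one has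
    \<open>s = 1\<close>, and every larger exponent has a finite conjugate.\<close>
  obtain s where s: "1 \<le> s" "conj_exp (q0 / q) = ennreal s"
    and s_gap: "\<And>s1. s < s1 \<Longrightarrow> ennreal (c * (s1 / (s1 - 1))) < q0"
  proof (cases "q0 = top")
    case True
    then have "conj_exp (q0 / q) = ennreal 1" using c by (simp add: conj_exp_def ennreal_top_divide)
    then show ?thesis using True that[of 1] by (simp add: less_top[symmetric])
  next
    case False
    then obtain d where d: "q0 = ennreal d" "0 \<le> d" by (cases q0) auto
    have cd: "c < d" using assms(9) c d by (simp add: ennreal_less_iff)
    have "q0 / q = ennreal (d / c)" using c d abc by (simp add: divide_ennreal)
    then have "conj_exp (q0 / q) = ennreal (d / c / (d / c - 1))"
      using cd abc by (simp add: conj_exp_ennreal)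
    also have "d / c / (d / c - 1) = d / (d - c)" using cd abc by (simp add: field_simps)
    finally have 1: "conj_exp (q0 / q) = ennreal (d / (d - c))" .
    have 2: "1 \<le> d / (d - c)" using cd abc by (simp add: field_simps)
    have "ennreal (c * (s1 / (s1 - 1))) < q0" if "d / (d - c) < s1" for s1
    proof -
      have "1 < s1" using that 2 by linarith
      moreover have "d < s1 * (d - c)" using that cd by (simp add: field_simps)
      ultimately have "c * (s1 / (s1 - 1)) < d" by (simp add: field_simps)
      then show ?thesis using d abc \<open>1 < s1\<close> by (simp add: ennreal_less_iff)
    qed
    then show ?thesis using 1 2 that by blast
  qed
  have wA: "w \<in> Ap M (ennreal P)" and wR: "w \<in> RH M (ennreal s)" using assms(10) P s by auto
  show ?thesis
  proof (cases "\<exists>x r. emeasure (W w) (ball x r) \<noteq> 0")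
    \<comment> \<open>Weights that vanish almost everywhere belong to \<open>Ap\<close>. Their
      averages are all 0, so arbitrary constants do.\<close>
    case False
    have zero: "Lp_avg (W w) q (ball x r) E g = 0" if "E \<subseteq> ball x r" for x r E and g :: "'a \<Rightarrow> 'b"
      using False that abc sets_M unfolding c by (intro Lp_avg_null) auto
    show ?thesis
      unfolding off_diagonal_on_balls_def
      by (intro exI[of _ 1] conjI) (auto simp: zero annulus_def)
  next
    case True
    then obtain x1 r1 where nz: "emeasure (W w) (ball x1 r1) \<noteq> 0" by blast
    note pw = Ap_dual_weight(1)[OF wA P(1) nz] and AEpos = Ap_dual_weight(3)[OF wA P(1) nz]
    obtain \<alpha> A where \<alpha>: "1 / (P - 1) < \<alpha>" and A: "0 < A"
      and dual: "\<And>x r. 0 < r \<Longrightarrow> (\<integral>\<^sup>+y\<in>ball x r. ennreal (w y powr (- \<alpha>)) \<partial>M)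
        \<le> ennreal (A * mean w x r powr (- \<alpha>) * measure M (ball x r))"
      using Ap_open_ended(1)[OF wA P(1) nz] by blast
    obtain \<beta> where \<beta>: "0 < \<beta>" "\<beta> < 1" "A_infinity \<beta> w"
      using Ap_open_ended(2)[OF wA P(1) nz] by blast
    obtain s1 B where s1: "s < s1" and B: "0 < B"
      and RH: "\<And>x r. 0 < r \<Longrightarrow> (\<integral>\<^sup>+y\<in>ball x r. ennreal (w y powr s1) \<partial>M)
        \<le> ennreal (B * mean w x r powr s1 * measure M (ball x r))"
      using RH_open_ended[OF wR s(1) \<beta>(3,1,2) AEpos] by blast
    have \<alpha>0: "0 < \<alpha>" using \<alpha> P(1) by (meson diff_gt_0_iff_gt less_trans zero_less_divide_1_iff)
    define p1 where "p1 = b * (\<alpha> / (1 + \<alpha>))"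
    define q1 where "q1 = c * (s1 / (s1 - 1))"
    \<comment> \<open>After clearing denominators this is \<open>p0 < p1\<close>; equality would
      correspond to \<open>p1 = p0\<close>.\<close>
    have "1 < \<alpha> * (P - 1)" using \<alpha> P(1) by (simp add: field_simps)
    then have "a < \<alpha> * (b - a)" using a by (simp add: P_def field_simps)
    then have p1: "a < p1" using \<alpha>0 by (simp add: p1_def field_simps)
    have "p1 \<le> b" using \<alpha>0 abc by (simp add: p1_def field_simps)
    also have "b \<le> c" by (rule abc)
    also have "c \<le> q1" using s1 s abc by (simp add: q1_def field_simps)
    finally have pq: "p1 \<le> q1" .
    \<comment> \<open>A single pair of exponents suffices; it depends on the weight through \<alpha>
      and \<open>s1\<close>.\<close>
    have "off_diagonal_on_balls M D T (ennreal p1) (ennreal q1)"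
      using assms(6) p1 pq s_gap[OF s1] a by (simp add: q1_def ennreal_less_iff ennreal_leI)
    then obtain \<theta>1 \<theta>2 k C where pos: "0 < \<theta>1" "0 < \<theta>2" "0 < k" "0 < C"
      and est: "\<forall>t>0. \<forall>x. \<forall>r>0. \<forall>f\<in>D.
        Lp_avg M (ennreal q1) (ball x r) (ball x r) (T t (trunc (ball x r) f))
          \<le> ennreal (C * Upsilon (r / sqrt t) powr \<theta>2) * Lp_avg M (ennreal p1) (ball x r) (ball x r) f \<and>
        (\<forall>j\<ge>2.
           Lp_avg M (ennreal q1) (ball x r) (ball x r) (T t (trunc (annulus x r j) f))
             \<le> ennreal (C * 2 powr (real j * \<theta>1) * Upsilon (2 ^ j * r / sqrt t) powr \<theta>2
                          * exp (- (k * 4 ^ j * r\<^sup>2 / t)))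
               * Lp_avg M (ennreal p1) (ball x (2 ^ (j + 1) * r)) (annulus x r j) f \<and>
           Lp_avg M (ennreal q1) (ball x (2 ^ (j + 1) * r)) (annulus x r j) (T t (trunc (ball x r) f))
             \<le> ennreal (C * 2 powr (real j * \<theta>1) * Upsilon (2 ^ j * r / sqrt t) powr \<theta>2
                          * exp (- (k * 4 ^ j * r\<^sup>2 / t)))
               * Lp_avg M (ennreal p1) (ball x r) (ball x r) f)"
      unfolding off_diagonal_on_balls_def by (elim exE conjE) (rule that)
    define K1 where "K1 = B powr (1 / (s1 * c))"
    define K2 where "K2 = A powr (1 / (b * \<alpha>))"
    have K: "0 < K1" "0 < K2" using A B by (auto simp: K1_def K2_def)
    have out: "Lp_avg (W w) q (ball x r) E g \<le> ennreal K1 * Lp_avg M (ennreal q1) (ball x r) E g"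
      if "0 < r" "E \<in> sets borel" "E \<subseteq> ball x r" "g \<in> borel_measurable M" for x r E and g :: "'a \<Rightarrow> 'b"
      unfolding c q1_def K1_def using that s1 s abc B RH by (intro Lp_avg_W_le_Lp_avg[OF pw]) auto
    have inn: "Lp_avg M (ennreal p1) (ball x r) E f \<le> ennreal K2 * Lp_avg (W w) p (ball x r) E f"
      if "0 < r" "E \<in> sets borel" "E \<subseteq> ball x r" "f \<in> D" for x r E f
      unfolding b p1_def K2_def using that \<alpha>0 abc A dual assms(4)
      by (intro Lp_avg_le_Lp_avg_W[OF pw AEpos]) (auto simp: truncation_space_def)
    have TM: "T t (trunc E f) \<in> borel_measurable M" if "0 < t" "E \<in> sets borel" "f \<in> D" for t E f
    proof -
      have "trunc E f \<in> D" using that assms(4) sets_M by (auto simp: truncation_space_def)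
      then show ?thesis using that assms(5) by (auto simp: sublinear_op_def)
    qed
    have ann: "annulus x r j \<in> sets borel" "annulus x r j \<subseteq> ball x (2 ^ (j + 1) * r)" for x :: 'a and r j
      by (auto simp: annulus_def)
    note balls = borel_open[OF open_ball]
    show ?thesis
      unfolding off_diagonal_on_balls_def
    proof (rule exI[of _ \<theta>1], rule conjI[OF pos(1)], rule exI[of _ \<theta>2], rule conjI[OF pos(2)],
        rule exI[of _ k], rule conjI[OF pos(3)], rule exI[of _ "K1 * K2 * C"], intro conjI allI impI ballI)
      show "0 < K1 * K2 * C" using K pos by simp
      fix t x r and f assume t: "0 < (t::real)" and r: "0 < (r::real)" and f: "f \<in> D"
      note est = est[rule_format, OF t r f]
      show "Lp_avg (W w) q (ball x r) (ball x r) (T t (trunc (ball x r) f))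
          \<le> ennreal (K1 * K2 * C * Upsilon (r / sqrt t) powr \<theta>2) * Lp_avg (W w) p (ball x r) (ball x r) f"
        using ennreal_mult_chain[OF out[OF r balls order_refl TM[OF t balls f]]
            est[of x, THEN conjunct1] inn[OF r balls order_refl f]] K pos
        by (simp add: mult.assoc)
      fix j :: nat assume j: "2 \<le> j"
      \<comment> \<open>Averages over an annulus are normalised by the dilated ball, so the
        comparison of averages is used there with this radius.\<close>
      have R: "0 < 2 ^ (j + 1) * r" using r by simp
      note est1 = est[of x, THEN conjunct2, rule_format, OF j, THEN conjunct1]
        and est2 = est[of x, THEN conjunct2, rule_format, OF j, THEN conjunct2]
      show "Lp_avg (W w) q (ball x r) (ball x r) (T t (trunc (annulus x r j) f))
          \<le> ennreal (K1 * K2 * C * 2 powr (real j * \<theta>1) * Upsilon (2 ^ j * r / sqrt t) powr \<theta>2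
                          * exp (- (k * 4 ^ j * r\<^sup>2 / t)))
            * Lp_avg (W w) p (ball x (2 ^ (j + 1) * r)) (annulus x r j) f"
        using ennreal_mult_chain[OF out[OF r balls order_refl TM[OF t ann(1) f]] est1 inn[OF R ann f]] K pos
        by (simp only: mult.assoc) simp
      show "Lp_avg (W w) q (ball x (2 ^ (j + 1) * r)) (annulus x r j) (T t (trunc (ball x r) f))
          \<le> ennreal (K1 * K2 * C * 2 powr (real j * \<theta>1) * Upsilon (2 ^ j * r / sqrt t) powr \<theta>2
                          * exp (- (k * 4 ^ j * r\<^sup>2 / t)))
            * Lp_avg (W w) p (ball x r) (ball x r) f"
        using ennreal_mult_chain[OF out[OF R ann TM[OF t balls f]] est2 inn[OF r balls order_refl f]] K pos
        by (simp only: mult.assoc) simp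
    qed
  qed
qed

end
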